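(* Let $H$ be a Hopf algebra over a field $k$ with adjoint map $\mathrm{ad}$, and let $D_1 : C^1_{\mathrm{ad}}(H;H)\to C^2_{\mathrm{ad}}(H;H)$ and $D_2 : C^2_{\mathrm{ad}}(H;H)\to C^3_{\mathrm{ad}}(H;H)$ be the first and second adjoint differentials. Then $D_2 D_1 = 0$.
   Context: $H$ is a Hopf algebra over a field $k$ with multiplication $\mu$, comultiplication $\Delta$, antipode $S$; Sweedler notation $\Delta(y)=y_{(1)}\otimes y_{(2)}$; $\tau(x\otimes y)=y\otimes x$; $1$ denotes an identity map inside formulas for maps. All Hom's are spaces of $k$-linear maps and tensor products are over $k$. Adjoint map: $\mathrm{ad}: H\otimes H\to H$, $\mathrm{ad}(x\otimes y)=S(y_{(1)})\,x\,y_{(2)}$. Cochain groups: $C^1_{\mathrm{ad}}(H;H)=\{f\in \mathrm{Hom}_k(H,H) : f\mu=\mu(f\otimes 1)+\mu(1\otimes f),\ \Delta f=(f\otimes 1)\Delta+(1\otimes f)\Delta\}$, $C^2_{\mathrm{ad}}(H;H)=\mathrm{Hom}(H^{\otimes 2},H)$, $C^3_{\mathrm{ad}}(H;H)=\mathrm{Hom}(H^{\otimes 3},H)\oplus \mathrm{Hom}(H^{\otimes 2},H^{\otimes 2})$. Differentials: for $f\in C^1_{\mathrm{ad}}(H;H)$, $D_1(f)=\mathrm{ad}(1\otimes f)-f\,\mathrm{ad}+\mathrm{ad}(f\otimes 1)$. For $\phi\in C^2_{\mathrm{ad}}(H;H)$, $D_2(\phi)=(d^{2,1}(\phi),d^{2,2}(\phi))$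 with $d^{2,1}(\phi)=\mathrm{ad}(\phi\otimes 1)+\phi(\mathrm{ad}\otimes 1)-\phi(1\otimes\mu)$, $d^{2,2}(\phi)=(\phi\otimes\mu)(1\otimes\tau\otimes 1)(\Delta\otimes\Delta)-(1\otimes\mu)(\tau\otimes 1)(1\otimes\Delta)(1\otimes\phi)(\tau\otimes 1)(1\otimes\Delta)$. *)

theory Defs
  imports "HOL-Algebra.Module" "HOL-Algebra.AbelCoset" "HOL-Library.FuncSet"
begin

section \<open>Linear maps and quotient modules\<close>

text \<open>
  Modules are \<open>HOL-Algebra\<close> records; the multiplicative fields \<^const>\<open>mult\<close> and \<^const>\<open>one\<close> are
  irrelevant for a mere module and left unspecified in the constructions below.
  Linear maps are extensional (\<^const>\<open>undefined\<close> off the carrier), so that equality in \<open>Hom\<close> is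
  equality of functions.
\<close>

definition linear_maps ::
    "('k, 'm) ring_scheme \<Rightarrow> ('k, 'a, 'n) module_scheme \<Rightarrow> ('k, 'b, 'p) module_scheme \<Rightarrow> ('a \<Rightarrow> 'b) set"
  where
  "linear_maps K M N = {f \<in> carrier M \<rightarrow>\<^sub>E carrier N.
     (\<forall>x \<in> carrier M. \<forall>y \<in> carrier M. f (x \<oplus>\<^bsub>M\<^esub> y) = f x \<oplus>\<^bsub>N\<^esub> f y) \<and>
     (\<forall>c \<in> carrier K. \<forall>x \<in> carrier M. f (c \<odot>\<^bsub>M\<^esub> x) = c \<odot>\<^bsub>N\<^esub> f x)}"

definition zero_map :: "('k, 'a, 'n) module_scheme \<Rightarrow> ('k, 'b, 'p) module_scheme \<Rightarrow> 'a \<Rightarrow> 'b"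
  where "zero_map M N = (\<lambda>x \<in> carrier M. \<zero>\<^bsub>N\<^esub>)"

definition base_module :: "('k, 'm) ring_scheme \<Rightarrow> ('k, 'k) module"
  where "base_module K = \<lparr>carrier = carrier K, mult = mult K, one = one K,
     zero = zero K, add = add K, smult = mult K\<rparr>"

definition quotient_module :: "('k, 'a, 'n) module_scheme \<Rightarrow> 'a set \<Rightarrow> ('k, 'a set) module"
  where "quotient_module M N = \<lparr>carrier = a_rcosets\<^bsub>M\<^esub> N, mult = undefined, one = undefined,
     zero = N, add = set_add M, smult = (\<lambda>c X. \<Union>x\<in>X. N +>\<^bsub>M\<^esub> (c \<odot>\<^bsub>M\<^esub> x))\<rparr>"


section \<open>Tensor products\<close>

text \<open>The free module on a set \<open>I\<close>: finitely supported functions \<open>I \<rightarrow> K\<close>, extended by zero.\<close>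

definition free_module :: "('k, 'm) ring_scheme \<Rightarrow> 'i set \<Rightarrow> ('k, 'i \<Rightarrow> 'k) module"
  where "free_module K I = \<lparr>
     carrier = {u. (\<forall>i. u i \<in> carrier K) \<and> (\<forall>i. i \<notin> I \<longrightarrow> u i = \<zero>\<^bsub>K\<^esub>) \<and> finite {i. u i \<noteq> \<zero>\<^bsub>K\<^esub>}},
     mult = undefined, one = undefined,
     zero = (\<lambda>i. \<zero>\<^bsub>K\<^esub>), add = (\<lambda>u v i. u i \<oplus>\<^bsub>K\<^esub> v i), smult = (\<lambda>c u i. c \<otimes>\<^bsub>K\<^esub> u i)\<rparr>"

definition free_gen :: "('k, 'm) ring_scheme \<Rightarrow> 'i \<Rightarrow> 'i \<Rightarrow> 'k"
  where "free_gen K i = (\<lambda>j. if j = i then \<one>\<^bsub>K\<^esub> else \<zero>\<^bsub>K\<^esub>)"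

text \<open>\<open>M \<otimes> N\<close> is the free module on \<open>M \<times> N\<close> modulo the submodule generated by the
  bilinearity relations.\<close>

definition tensor_relations ::
    "('k, 'm) ring_scheme \<Rightarrow> ('k, 'a, 'n) module_scheme \<Rightarrow> ('k, 'b, 'p) module_scheme
      \<Rightarrow> ('a \<times> 'b \<Rightarrow> 'k) set"
  where
  "tensor_relations K M N =
     (let F = free_module K (carrier M \<times> carrier N); e = (\<lambda>x y. free_gen K (x, y)) in
       {e (x \<oplus>\<^bsub>M\<^esub> x') y \<ominus>\<^bsub>F\<^esub> (e x y \<oplus>\<^bsub>F\<^esub> e x' y) | x x' y.
          x \<in> carrier M \<and> x' \<in> carrier M \<and> y \<in> carrier N} \<union>
       {e x (y \<oplus>\<^bsub>N\<^esub> y') \<ominus>\<^bsub>F\<^esub> (e x y \<oplus>\<^bsub>F\<^esub> e x y') | x y y'.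
          x \<in> carrier M \<and> y \<in> carrier N \<and> y' \<in> carrier N} \<union>
       {e (c \<odot>\<^bsub>M\<^esub> x) y \<ominus>\<^bsub>F\<^esub> c \<odot>\<^bsub>F\<^esub> e x y | c x y.
          c \<in> carrier K \<and> x \<in> carrier M \<and> y \<in> carrier N} \<union>
       {e x (c \<odot>\<^bsub>N\<^esub> y) \<ominus>\<^bsub>F\<^esub> c \<odot>\<^bsub>F\<^esub> e x y | c x y.
          c \<in> carrier K \<and> x \<in> carrier M \<and> y \<in> carrier N})"

definition tensor_kernel ::
    "('k, 'm) ring_scheme \<Rightarrow> ('k, 'a, 'n) module_scheme \<Rightarrow> ('k, 'b, 'p) module_scheme
      \<Rightarrow> ('a \<times> 'b \<Rightarrow> 'k) set"
  where
  "tensor_kernel K M N =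
     \<Inter> {U. submodule U K (free_module K (carrier M \<times> carrier N)) \<and> tensor_relations K M N \<subseteq> U}"

definition tensor ::
    "('k, 'm) ring_scheme \<Rightarrow> ('k, 'a, 'n) module_scheme \<Rightarrow> ('k, 'b, 'p) module_scheme
      \<Rightarrow> ('k, ('a \<times> 'b \<Rightarrow> 'k) set) module"
  where
  "tensor K M N = quotient_module (free_module K (carrier M \<times> carrier N)) (tensor_kernel K M N)"

definition pure_tensor ::
    "('k, 'm) ring_scheme \<Rightarrow> ('k, 'a, 'n) module_scheme \<Rightarrow> ('k, 'b, 'p) module_scheme
      \<Rightarrow> 'a \<Rightarrow> 'b \<Rightarrow> ('a \<times> 'b \<Rightarrow> 'k) set"
  where
  "pure_tensor K M N x y =
     tensor_kernel K M N +>\<^bsub>free_module K (carrier M \<times> carrier N)\<^esub> free_gen K (x, y)"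

text \<open>
  The unique linear map \<open>M \<otimes> N \<rightarrow> P\<close> with \<open>x \<otimes> y \<mapsto> b x y\<close>; it exists
  whenever \<open>b\<close> is bilinear, by the universal property of the tensor product.
\<close>

definition tensor_lift ::
    "('k, 'm) ring_scheme \<Rightarrow> ('k, 'a, 'n) module_scheme \<Rightarrow> ('k, 'b, 'p) module_scheme
      \<Rightarrow> ('k, 'c, 'q) module_scheme \<Rightarrow> ('a \<Rightarrow> 'b \<Rightarrow> 'c) \<Rightarrow> ('a \<times> 'b \<Rightarrow> 'k) set \<Rightarrow> 'c"
  where
  "tensor_lift K M N P b = (THE h. h \<in> linear_maps K (tensor K M N) P \<and>
     (\<forall>x \<in> carrier M. \<forall>y \<in> carrier N. h (pure_tensor K M N x y) = b x y))"

text \<open>\<open>f \<otimes> g : M \<otimes> N \<rightarrow> M' \<otimes> N'\<close> for \<open>f : M \<rightarrow> M'\<close> and \<open>g : N \<rightarrow> N'\<close>.\<close>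

definition tensor_map ::
    "('k, 'm) ring_scheme \<Rightarrow> ('k, 'a, 'n) module_scheme \<Rightarrow> ('k, 'b, 'p) module_scheme
      \<Rightarrow> ('k, 'c, 'q) module_scheme \<Rightarrow> ('k, 'd, 'r) module_scheme
      \<Rightarrow> ('a \<Rightarrow> 'c) \<Rightarrow> ('b \<Rightarrow> 'd) \<Rightarrow> ('a \<times> 'b \<Rightarrow> 'k) set \<Rightarrow> ('c \<times> 'd \<Rightarrow> 'k) set"
  where
  "tensor_map K M N M' N' f g =
     tensor_lift K M N (tensor K M' N') (\<lambda>x y. pure_tensor K M' N' (f x) (g y))"

definition tensor_swap ::
    "('k, 'm) ring_scheme \<Rightarrow> ('k, 'a, 'n) module_scheme \<Rightarrow> ('k, 'b, 'p) module_scheme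
      \<Rightarrow> ('a \<times> 'b \<Rightarrow> 'k) set \<Rightarrow> ('b \<times> 'a \<Rightarrow> 'k) set"
  where
  "tensor_swap K M N = tensor_lift K M N (tensor K N M) (\<lambda>x y. pure_tensor K N M y x)"

text \<open>The canonical isomorphism \<open>(M \<otimes> N) \<otimes> P \<rightarrow> M \<otimes> (N \<otimes> P)\<close> and its inverse.\<close>

definition tensor_assoc ::
    "('k, 'm) ring_scheme \<Rightarrow> ('k, 'a, 'n) module_scheme \<Rightarrow> ('k, 'b, 'p) module_scheme
      \<Rightarrow> ('k, 'c, 'q) module_scheme
      \<Rightarrow> (('a \<times> 'b \<Rightarrow> 'k) set \<times> 'c \<Rightarrow> 'k) set \<Rightarrow> ('a \<times> ('b \<times> 'c \<Rightarrow> 'k) set \<Rightarrow> 'k) set"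
  where
  "tensor_assoc K M N P =
     tensor_lift K (tensor K M N) P (tensor K M (tensor K N P))
       (\<lambda>t z. tensor_lift K M N (tensor K M (tensor K N P))
          (\<lambda>x y. pure_tensor K M (tensor K N P) x (pure_tensor K N P y z)) t)"

definition tensor_assoc_inv ::
    "('k, 'm) ring_scheme \<Rightarrow> ('k, 'a, 'n) module_scheme \<Rightarrow> ('k, 'b, 'p) module_scheme
      \<Rightarrow> ('k, 'c, 'q) module_scheme
      \<Rightarrow> ('a \<times> ('b \<times> 'c \<Rightarrow> 'k) set \<Rightarrow> 'k) set \<Rightarrow> (('a \<times> 'b \<Rightarrow> 'k) set \<times> 'c \<Rightarrow> 'k) set"
  where
  "tensor_assoc_inv K M N P =
     tensor_lift K M (tensor K N P) (tensor K (tensor K M N) P)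
       (\<lambda>x t. tensor_lift K N P (tensor K (tensor K M N) P)
          (\<lambda>y z. pure_tensor K (tensor K M N) P (pure_tensor K M N x y) z) t)"


section \<open>Hopf algebras\<close>

text \<open>
  The multiplication and unit of \<open>H\<close> are those of the module record \<open>H\<close>; the comultiplication
  \<open>\<Delta>\<close>, counit \<open>\<epsilon>\<close> and antipode \<open>S\<close> are separate. The locale \<open>hopf_data\<close> assumes nothing and only serves
  to name the maps built from these data. Iterated tensor products are not strictly associative
  here, so the associators are written out; the names record the bracketing.
\<close>

locale hopf_data =
  fixes K :: "('k, 'm) ring_scheme"
    and H :: "('k, 'a, 'n) module_scheme"
    and \<Delta> :: "'a \<Rightarrow> ('a \<times> 'a \<Rightarrow> 'k) set"
    and \<epsilon> :: "'a \<Rightarrow> 'k"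
    and S :: "'a \<Rightarrow> 'a"
begin

abbreviation "HH \<equiv> tensor K H H"
abbreviation "HH_H \<equiv> tensor K HH H"
abbreviation "H_HH \<equiv> tensor K H HH"
abbreviation "HH_HH \<equiv> tensor K HH HH"
abbreviation "H_H_HH \<equiv> tensor K H H_HH"

abbreviation "one_H \<equiv> (\<lambda>x \<in> carrier H. x)"
abbreviation "one_HH \<equiv> (\<lambda>x \<in> carrier HH. x)"

definition \<mu> :: "('a \<times> 'a \<Rightarrow> 'k) set \<Rightarrow> 'a"
  where "\<mu> = tensor_lift K H H H (\<lambda>x y. x \<otimes>\<^bsub>H\<^esub> y)"

abbreviation "\<alpha> \<equiv> tensor_assoc K H H H"
abbreviation "\<alpha>_inv \<equiv> tensor_assoc_inv K H H H"

text \<open>\<open>\<tau> \<otimes> 1\<close> on \<open>H \<otimes> H \<otimes> H\<close>, bracketed as \<open>H \<otimes> (H \<otimes> H)\<close>.\<close>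

definition swap_left
  where "swap_left = \<alpha> \<circ> tensor_map K HH H HH H (tensor_swap K H H) one_H \<circ> \<alpha>_inv"

text \<open>\<open>1 \<otimes> \<tau> \<otimes> 1\<close> on \<open>H \<otimes> H \<otimes> H \<otimes> H\<close>, bracketed as \<open>(H \<otimes> H) \<otimes> (H \<otimes> H)\<close>.\<close>

definition swap_middle
  where "swap_middle = tensor_assoc_inv K H H HH \<circ>
     tensor_map K H H_HH H H_HH one_H swap_left \<circ> tensor_assoc K H H HH"

end

locale hopf_algebra = hopf_data K H \<Delta> \<epsilon> S + K: field K + H: ring H + module K H
  for K :: "('k, 'm) ring_scheme" and H :: "('k, 'a, 'n) module_scheme" and \<Delta> \<epsilon> S +
  assumes smult_mult_left: "\<lbrakk>c \<in> carrier K; x \<in> carrier H; y \<in> carrier H\<rbrakk> \<Longrightarrow>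
      (c \<odot>\<^bsub>H\<^esub> x) \<otimes>\<^bsub>H\<^esub> y = c \<odot>\<^bsub>H\<^esub> (x \<otimes>\<^bsub>H\<^esub> y)"
    and smult_mult_right: "\<lbrakk>c \<in> carrier K; x \<in> carrier H; y \<in> carrier H\<rbrakk> \<Longrightarrow>
      x \<otimes>\<^bsub>H\<^esub> (c \<odot>\<^bsub>H\<^esub> y) = c \<odot>\<^bsub>H\<^esub> (x \<otimes>\<^bsub>H\<^esub> y)"
    and comult_linear: "\<Delta> \<in> linear_maps K H HH"
    and counit_linear: "\<epsilon> \<in> linear_maps K H (base_module K)"
    and antipode_linear: "S \<in> linear_maps K H H"
    and coassoc: "x \<in> carrier H \<Longrightarrow>
      \<alpha> (tensor_map K H H HH H \<Delta> one_H (\<Delta> x)) = tensor_map K H H H HH one_H \<Delta> (\<Delta> x)"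
    and counit_left: "x \<in> carrier H \<Longrightarrow>
      tensor_lift K (base_module K) H H (\<lambda>c y. c \<odot>\<^bsub>H\<^esub> y)
        (tensor_map K H H (base_module K) H \<epsilon> one_H (\<Delta> x)) = x"
    and counit_right: "x \<in> carrier H \<Longrightarrow>
      tensor_lift K H (base_module K) H (\<lambda>y c. c \<odot>\<^bsub>H\<^esub> y)
        (tensor_map K H H H (base_module K) one_H \<epsilon> (\<Delta> x)) = x"
    and comult_mult: "t \<in> carrier HH \<Longrightarrow>
      \<Delta> (\<mu> t) = tensor_map K HH HH H H \<mu> \<mu> (swap_middle (tensor_map K H H HH HH \<Delta> \<Delta> t))"
    and comult_one: "\<Delta> \<one>\<^bsub>H\<^esub> = pure_tensor K H H \<one>\<^bsub>H\<^esub> \<one>\<^bsub>H\<^esub>"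
    and counit_mult: "\<lbrakk>x \<in> carrier H; y \<in> carrier H\<rbrakk> \<Longrightarrow> \<epsilon> (x \<otimes>\<^bsub>H\<^esub> y) = \<epsilon> x \<otimes>\<^bsub>K\<^esub> \<epsilon> y"
    and counit_one: "\<epsilon> \<one>\<^bsub>H\<^esub> = \<one>\<^bsub>K\<^esub>"
    and antipode_left: "x \<in> carrier H \<Longrightarrow>
      \<mu> (tensor_map K H H H H S one_H (\<Delta> x)) = \<epsilon> x \<odot>\<^bsub>H\<^esub> \<one>\<^bsub>H\<^esub>"
    and antipode_right: "x \<in> carrier H \<Longrightarrow>
      \<mu> (tensor_map K H H H H one_H S (\<Delta> x)) = \<epsilon> x \<odot>\<^bsub>H\<^esub> \<one>\<^bsub>H\<^esub>"


section \<open>The adjoint cochain complex in low degrees\<close>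

context hopf_data
begin

text \<open>\<open>ad (x \<otimes> y) = S y\<^sub>1 \<cdot> x \<cdot> y\<^sub>2\<close>: the Sweedler expression is the value at \<open>\<Delta> y\<close> of the linear map
  induced by \<open>(a, b) \<mapsto> S a \<cdot> x \<cdot> b\<close>.\<close>

definition ad :: "('a \<times> 'a \<Rightarrow> 'k) set \<Rightarrow> 'a"
  where "ad = tensor_lift K H H H
     (\<lambda>x y. tensor_lift K H H H (\<lambda>a b. S a \<otimes>\<^bsub>H\<^esub> x \<otimes>\<^bsub>H\<^esub> b) (\<Delta> y))"

definition C1 :: "('a \<Rightarrow> 'a) set"
  where "C1 = {f \<in> linear_maps K H H.
     (\<forall>t \<in> carrier HH. f (\<mu> t) =
        \<mu> (tensor_map K H H H H f one_H t) \<oplus>\<^bsub>H\<^esub> \<mu> (tensor_map K H H H H one_H f t)) \<and>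
     (\<forall>x \<in> carrier H. \<Delta> (f x) =
        tensor_map K H H H H f one_H (\<Delta> x) \<oplus>\<^bsub>HH\<^esub> tensor_map K H H H H one_H f (\<Delta> x))}"

definition C2 :: "(('a \<times> 'a \<Rightarrow> 'k) set \<Rightarrow> 'a) set"
  where "C2 = linear_maps K HH H"

definition C3 :: "(((('a \<times> 'a \<Rightarrow> 'k) set \<times> 'a \<Rightarrow> 'k) set \<Rightarrow> 'a) \<times>
    (('a \<times> 'a \<Rightarrow> 'k) set \<Rightarrow> ('a \<times> 'a \<Rightarrow> 'k) set)) set"
  where "C3 = linear_maps K HH_H H \<times> linear_maps K HH HH"

definition zero_C3 :: "((('a \<times> 'a \<Rightarrow> 'k) set \<times> 'a \<Rightarrow> 'k) set \<Rightarrow> 'a) \<times>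
    (('a \<times> 'a \<Rightarrow> 'k) set \<Rightarrow> ('a \<times> 'a \<Rightarrow> 'k) set)"
  where "zero_C3 = (zero_map HH_H H, zero_map HH HH)"

definition D1 :: "('a \<Rightarrow> 'a) \<Rightarrow> ('a \<times> 'a \<Rightarrow> 'k) set \<Rightarrow> 'a"
  where "D1 f = (\<lambda>t \<in> carrier HH.
     ad (tensor_map K H H H H one_H f t) \<ominus>\<^bsub>H\<^esub> f (ad t) \<oplus>\<^bsub>H\<^esub> ad (tensor_map K H H H H f one_H t))"

definition d21 :: "(('a \<times> 'a \<Rightarrow> 'k) set \<Rightarrow> 'a) \<Rightarrow> (('a \<times> 'a \<Rightarrow> 'k) set \<times> 'a \<Rightarrow> 'k) set \<Rightarrow> 'a"
  where "d21 \<phi> = (\<lambda>t \<in> carrier HH_H.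
     ad (tensor_map K HH H H H \<phi> one_H t)
     \<oplus>\<^bsub>H\<^esub> \<phi> (tensor_map K HH H H H ad one_H t)
     \<ominus>\<^bsub>H\<^esub> \<phi> (tensor_map K H HH H H one_H \<mu> (\<alpha> t)))"

definition d22 :: "(('a \<times> 'a \<Rightarrow> 'k) set \<Rightarrow> 'a) \<Rightarrow> ('a \<times> 'a \<Rightarrow> 'k) set \<Rightarrow> ('a \<times> 'a \<Rightarrow> 'k) set"
  where "d22 \<phi> = (\<lambda>t \<in> carrier HH.
     (tensor_map K HH HH H H \<phi> \<mu> \<circ> swap_middle \<circ> tensor_map K H H HH HH \<Delta> \<Delta>) t
     \<ominus>\<^bsub>HH\<^esub>
     (tensor_map K H HH H H one_H \<mu> \<circ> swap_left \<circ> tensor_map K H H H HH one_H \<Delta> \<circ>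
      tensor_map K H HH H H one_H \<phi> \<circ> swap_left \<circ> tensor_map K H H H HH one_H \<Delta>) t)"

definition D2 :: "(('a \<times> 'a \<Rightarrow> 'k) set \<Rightarrow> 'a) \<Rightarrow>
    ((('a \<times> 'a \<Rightarrow> 'k) set \<times> 'a \<Rightarrow> 'k) set \<Rightarrow> 'a) \<times>
    (('a \<times> 'a \<Rightarrow> 'k) set \<Rightarrow> ('a \<times> 'a \<Rightarrow> 'k) set)"
  where "D2 \<phi> = (d21 \<phi>, d22 \<phi>)"

end

end

theory Submission
  imports Defs
begin

text \<open>
  In fact \<open>D\<^sub>1 = 0\<close> already. A map \<open>f\<close> that is both a derivation and a coderivation kills \<open>1\<close>
  and satisfies \<open>\<epsilon> f = 0\<close>. Applying \<open>f\<close> to \<open>S y\<^sub>1 y\<^sub>2 = \<epsilon> y\<close>, and substituting \<open>f y\<close> for \<open>y\<close> in it,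
  shows that \<open>f S\<close> and \<open>S f\<close> have the same convolution product with the identity, so \<open>f S = S f\<close>.
  Expanding \<open>f (S y\<^sub>1 x y\<^sub>2)\<close> by the Leibniz rule then makes the three terms of
  \<open>D\<^sub>1 f\<close> cancel.
\<close>

section \<open>Linear and bilinear maps\<close>

text \<open>Sweedler sums cannot be written down directly: \<open>\<Delta> x\<close> is an opaque
  coset, and every map out of a tensor product is a \<open>THE\<close>-description that means
  nothing until existence and uniqueness are known. The universal property of the tensor product is
  therefore established before any Hopf algebra argument. After that, a Sweedler computation at
  \<open>\<Delta> x\<close> is generalised to an arbitrary tensor \<open>t\<close>: both sides are
  shown linear in \<open>t\<close>, compared on pure tensors, and only then specialised.

  The conditions defining \<open>C1\<close> mention neither unit, counit nor antipode, so
  compatibility of \<open>f\<close> with all three has to be derived. The common convolution factor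
  can be cancelled because the identity is invertible under convolution, with inverse
  \<open>S\<close>. Once \<open>D1 f\<close> is the zero map, what remains is \<open>D2\<close> at
  zero; this still rests on linearity of the associators and swaps that the differential composes
  with.\<close>

text \<open>Linearity without the extensionality demanded by \<^const>\<open>linear_maps\<close>, so that it is stable
  under composition and pointwise operations.\<close>

definition is_linear where
  "is_linear K M N f \<longleftrightarrow>
     (\<forall>x \<in> carrier M. f x \<in> carrier N) \<and>
     (\<forall>x \<in> carrier M. \<forall>y \<in> carrier M. f (x \<oplus>\<^bsub>M\<^esub> y) = f x \<oplus>\<^bsub>N\<^esub> f y) \<and>
     (\<forall>c \<in> carrier K. \<forall>x \<in> carrier M. f (c \<odot>\<^bsub>M\<^esub> x) = c \<odot>\<^bsub>N\<^esub> f x)"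

lemma is_linearI:
  assumes "\<And>x. x \<in> carrier M \<Longrightarrow> f x \<in> carrier N"
    and "\<And>x y. \<lbrakk>x \<in> carrier M; y \<in> carrier M\<rbrakk> \<Longrightarrow> f (x \<oplus>\<^bsub>M\<^esub> y) = f x \<oplus>\<^bsub>N\<^esub> f y"
    and "\<And>c x. \<lbrakk>c \<in> carrier K; x \<in> carrier M\<rbrakk> \<Longrightarrow> f (c \<odot>\<^bsub>M\<^esub> x) = c \<odot>\<^bsub>N\<^esub> f x"
  shows "is_linear K M N f"
  using assms by (simp add: is_linear_def)

lemma is_linearD:
  assumes "is_linear K M N f"
  shows is_linear_closed: "\<And>x. x \<in> carrier M \<Longrightarrow> f x \<in> carrier N"
    and is_linear_add: "\<And>x y. \<lbrakk>x \<in> carrier M; y \<in> carrier M\<rbrakk> \<Longrightarrow> f (x \<oplus>\<^bsub>M\<^esub> y) = f x \<oplus>\<^bsub>N\<^esub> f y"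
    and is_linear_smult: "\<And>c x. \<lbrakk>c \<in> carrier K; x \<in> carrier M\<rbrakk> \<Longrightarrow> f (c \<odot>\<^bsub>M\<^esub> x) = c \<odot>\<^bsub>N\<^esub> f x"
  using assms by (simp_all add: is_linear_def)

lemma linear_maps_iff: "f \<in> linear_maps K M N \<longleftrightarrow> is_linear K M N f \<and> f \<in> extensional (carrier M)"
  by (auto simp: linear_maps_def is_linear_def PiE_def)

lemma linear_maps_is_linear: "f \<in> linear_maps K M N \<Longrightarrow> is_linear K M N f"
  by (simp add: linear_maps_iff)

lemma is_linear_zero:
  assumes "is_linear K M N f" "module K M" "module K N"
  shows "f \<zero>\<^bsub>M\<^esub> = \<zero>\<^bsub>N\<^esub>"
proof -
  interpret M: module K M by fact
  interpret N: module K N by fact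
  have "f (\<zero>\<^bsub>K\<^esub> \<odot>\<^bsub>M\<^esub> \<zero>\<^bsub>M\<^esub>) = \<zero>\<^bsub>K\<^esub> \<odot>\<^bsub>N\<^esub> f \<zero>\<^bsub>M\<^esub>"
    by (rule is_linear_smult[OF assms(1)]) auto
  then show ?thesis
    using is_linear_closed[OF assms(1)] by simp
qed

lemma is_linear_cong:
  assumes "module K M" "is_linear K M N g" "\<And>x. x \<in> carrier M \<Longrightarrow> f x = g x"
  shows "is_linear K M N f"
proof -
  interpret M: module K M by fact
  show ?thesis
    using assms(2,3) by (intro is_linearI) (simp_all add: is_linearD)
qed

lemma is_linear_id: "is_linear K M M (\<lambda>x. x)"
  by (rule is_linearI) auto

lemma is_linear_restrict_id:
  assumes "module K M"
  shows "is_linear K M M (\<lambda>x\<in>carrier M. x)"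
  by (rule is_linear_cong[OF assms is_linear_id]) simp

lemma is_linear_comp:
  assumes "is_linear K N P g" "is_linear K M N f"
  shows "is_linear K M P (\<lambda>x. g (f x))"
  using assms by (intro is_linearI) (simp_all add: is_linearD)

lemma is_linear_plus:
  assumes "module K N" "is_linear K M N f" "is_linear K M N g"
  shows "is_linear K M N (\<lambda>x. f x \<oplus>\<^bsub>N\<^esub> g x)"
proof -
  interpret N: module K N by fact
  show ?thesis
    using is_linearD[OF assms(2)] is_linearD[OF assms(3)]
    by (intro is_linearI) (simp_all add: N.smult_r_distr N.M.a_ac)
qed

lemma is_linear_smult_comp:
  assumes "module K N" "c \<in> carrier K" "is_linear K M N f"
  shows "is_linear K M N (\<lambda>x. c \<odot>\<^bsub>N\<^esub> f x)"
proof -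
  interpret N: module K N by fact
  show ?thesis
    using is_linearD[OF assms(3)] assms(2)
    by (intro is_linearI) (simp_all add: N.smult_r_distr N.smult_assoc1[symmetric] N.R.m_comm)
qed

lemma is_linear_diff:
  assumes "module K N" "is_linear K M N f" "is_linear K M N g"
  shows "is_linear K M N (\<lambda>x. f x \<ominus>\<^bsub>N\<^esub> g x)"
proof -
  interpret N: module K N by fact
  show ?thesis
    using is_linearD[OF assms(2)] is_linearD[OF assms(3)]
    by (intro is_linearI)
      (simp_all add: a_minus_def N.smult_r_distr N.smult_r_minus N.M.minus_add N.M.a_ac)
qed

lemma is_linear_const_zero:
  assumes "module K N"
  shows "is_linear K M N (\<lambda>x. \<zero>\<^bsub>N\<^esub>)"
proof -
  interpret N: module K N by fact
  show ?thesis
    by (intro is_linearI) simp_all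
qed

section \<open>Bilinear maps\<close>

definition bilinear_map where
  "bilinear_map K M N P b \<longleftrightarrow>
     (\<forall>x \<in> carrier M. \<forall>y \<in> carrier N. b x y \<in> carrier P) \<and>
     (\<forall>x \<in> carrier M. \<forall>x' \<in> carrier M. \<forall>y \<in> carrier N. b (x \<oplus>\<^bsub>M\<^esub> x') y = b x y \<oplus>\<^bsub>P\<^esub> b x' y) \<and>
     (\<forall>x \<in> carrier M. \<forall>y \<in> carrier N. \<forall>y' \<in> carrier N. b x (y \<oplus>\<^bsub>N\<^esub> y') = b x y \<oplus>\<^bsub>P\<^esub> b x y') \<and>
     (\<forall>c \<in> carrier K. \<forall>x \<in> carrier M. \<forall>y \<in> carrier N. b (c \<odot>\<^bsub>M\<^esub> x) y = c \<odot>\<^bsub>P\<^esub> b x y) \<and>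
     (\<forall>c \<in> carrier K. \<forall>x \<in> carrier M. \<forall>y \<in> carrier N. b x (c \<odot>\<^bsub>N\<^esub> y) = c \<odot>\<^bsub>P\<^esub> b x y)"

lemma bilinear_mapI:
  assumes "\<And>x y. \<lbrakk>x \<in> carrier M; y \<in> carrier N\<rbrakk> \<Longrightarrow> b x y \<in> carrier P"
    and "\<And>x x' y. \<lbrakk>x \<in> carrier M; x' \<in> carrier M; y \<in> carrier N\<rbrakk> \<Longrightarrow>
      b (x \<oplus>\<^bsub>M\<^esub> x') y = b x y \<oplus>\<^bsub>P\<^esub> b x' y"
    and "\<And>x y y'. \<lbrakk>x \<in> carrier M; y \<in> carrier N; y' \<in> carrier N\<rbrakk> \<Longrightarrow>
      b x (y \<oplus>\<^bsub>N\<^esub> y') = b x y \<oplus>\<^bsub>P\<^esub> b x y'"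
    and "\<And>c x y. \<lbrakk>c \<in> carrier K; x \<in> carrier M; y \<in> carrier N\<rbrakk> \<Longrightarrow> b (c \<odot>\<^bsub>M\<^esub> x) y = c \<odot>\<^bsub>P\<^esub> b x y"
    and "\<And>c x y. \<lbrakk>c \<in> carrier K; x \<in> carrier M; y \<in> carrier N\<rbrakk> \<Longrightarrow> b x (c \<odot>\<^bsub>N\<^esub> y) = c \<odot>\<^bsub>P\<^esub> b x y"
  shows "bilinear_map K M N P b"
  using assms by (auto simp: bilinear_map_def)

lemma bilinear_mapD:
  assumes "bilinear_map K M N P b"
  shows "\<And>x y. \<lbrakk>x \<in> carrier M; y \<in> carrier N\<rbrakk> \<Longrightarrow> b x y \<in> carrier P"
    and "\<And>x x' y. \<lbrakk>x \<in> carrier M; x' \<in> carrier M; y \<in> carrier N\<rbrakk> \<Longrightarrow>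
      b (x \<oplus>\<^bsub>M\<^esub> x') y = b x y \<oplus>\<^bsub>P\<^esub> b x' y"
    and "\<And>x y y'. \<lbrakk>x \<in> carrier M; y \<in> carrier N; y' \<in> carrier N\<rbrakk> \<Longrightarrow>
      b x (y \<oplus>\<^bsub>N\<^esub> y') = b x y \<oplus>\<^bsub>P\<^esub> b x y'"
    and "\<And>c x y. \<lbrakk>c \<in> carrier K; x \<in> carrier M; y \<in> carrier N\<rbrakk> \<Longrightarrow> b (c \<odot>\<^bsub>M\<^esub> x) y = c \<odot>\<^bsub>P\<^esub> b x y"
    and "\<And>c x y. \<lbrakk>c \<in> carrier K; x \<in> carrier M; y \<in> carrier N\<rbrakk> \<Longrightarrow> b x (c \<odot>\<^bsub>N\<^esub> y) = c \<odot>\<^bsub>P\<^esub> b x y"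
  using assms by (auto simp: bilinear_map_def)

text \<open>The five equations suit the simplifier, while separate linearity in each slot lets
  closure of linear maps under composition do the work; proofs move between the two forms.\<close>

lemma bilinear_map_iff:
  "bilinear_map K M N P b \<longleftrightarrow>
     (\<forall>y \<in> carrier N. is_linear K M P (\<lambda>x. b x y)) \<and> (\<forall>x \<in> carrier M. is_linear K N P (b x))"
  unfolding bilinear_map_def is_linear_def by blast

lemma bilinear_map_left: "\<lbrakk>bilinear_map K M N P b; y \<in> carrier N\<rbrakk> \<Longrightarrow> is_linear K M P (\<lambda>x. b x y)"
  by (simp add: bilinear_map_iff)

lemma bilinear_map_right: "\<lbrakk>bilinear_map K M N P b; x \<in> carrier M\<rbrakk> \<Longrightarrow> is_linear K N P (b x)"
  by (simp add: bilinear_map_iff)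

lemma bilinear_map_comp:
  assumes "bilinear_map K M' N' P b" "is_linear K M M' f" "is_linear K N N' g"
  shows "bilinear_map K M N P (\<lambda>x y. b (f x) (g y))"
  using assms unfolding bilinear_map_iff
  by (auto intro: is_linear_comp[of K M' P "\<lambda>z. b z _"] is_linear_comp[of K N' P "b _"]
      simp: is_linear_closed)

lemma base_module_module:
  assumes "cring K"
  shows "module K (base_module K)"
proof -
  interpret cring K by fact
  have "abelian_group (base_module K)"
    by (rule abelian_groupI)
      (auto simp: base_module_def a_ac intro: bexI[where x = "\<ominus>\<^bsub>K\<^esub> _"] l_neg)
  then show ?thesis
    by (intro moduleI assms) (auto simp: base_module_def l_distr r_distr m_assoc)
qed

section \<open>Free and quotient modules\<close>

lemma free_module_simps [simp]:
  "\<zero>\<^bsub>free_module K I\<^esub> = (\<lambda>i. \<zero>\<^bsub>K\<^esub>)"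
  "u \<oplus>\<^bsub>free_module K I\<^esub> v = (\<lambda>i. u i \<oplus>\<^bsub>K\<^esub> v i)"
  "c \<odot>\<^bsub>free_module K I\<^esub> u = (\<lambda>i. c \<otimes>\<^bsub>K\<^esub> u i)"
  by (auto simp: free_module_def)

lemma free_module_carrier:
  "u \<in> carrier (free_module K I) \<longleftrightarrow>
     (\<forall>i. u i \<in> carrier K) \<and> (\<forall>i. i \<notin> I \<longrightarrow> u i = \<zero>\<^bsub>K\<^esub>) \<and> finite {i. u i \<noteq> \<zero>\<^bsub>K\<^esub>}"
  by (auto simp: free_module_def)

context cring
begin

lemma free_module_add_closed:
  assumes "u \<in> carrier (free_module R I)" "v \<in> carrier (free_module R I)"
  shows "(\<lambda>i. u i \<oplus> v i) \<in> carrier (free_module R I)"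
proof -
  have "finite ({i. u i \<noteq> \<zero>} \<union> {i. v i \<noteq> \<zero>})"
    using assms by (auto simp: free_module_carrier)
  then have "finite {i. u i \<oplus> v i \<noteq> \<zero>}"
    by (rule rev_finite_subset) auto
  then show ?thesis
    using assms by (auto simp: free_module_carrier)
qed

lemma free_module_smult_closed:
  assumes "c \<in> carrier R" "u \<in> carrier (free_module R I)"
  shows "(\<lambda>i. c \<otimes> u i) \<in> carrier (free_module R I)"
proof -
  have "finite {i. u i \<noteq> \<zero>}"
    using assms by (auto simp: free_module_carrier)
  then have "finite {i. c \<otimes> u i \<noteq> \<zero>}"
    by (rule rev_finite_subset) (use assms in auto)
  then show ?thesis
    using assms by (auto simp: free_module_carrier)
qed

lemma free_module_module: "module R (free_module R I)"
proof -
  have "abelian_group (free_module R I)"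
  proof (rule abelian_groupI)
    fix u assume u: "u \<in> carrier (free_module R I)"
    show "\<exists>v \<in> carrier (free_module R I). v \<oplus>\<^bsub>free_module R I\<^esub> u = \<zero>\<^bsub>free_module R I\<^esub>"
    proof (rule bexI)
      \<comment> \<open>The additive inverse is written as multiplication by minus one, so that
        finiteness of its support comes from closure under scalars.\<close>
      show "(\<lambda>i. \<ominus> \<one> \<otimes> u i) \<in> carrier (free_module R I)"
        by (rule free_module_smult_closed) (use u in auto)
    qed (use u in \<open>auto simp: free_module_carrier l_minus l_neg\<close>)
  next
    show "\<zero>\<^bsub>free_module R I\<^esub> \<in> carrier (free_module R I)"
      by (simp add: free_module_carrier)
  qed (auto simp: free_module_add_closed, auto simp: free_module_carrier a_ac)
  then show ?thesis
    by (intro moduleI is_cring)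
      (auto simp: free_module_smult_closed, auto simp: free_module_carrier l_distr r_distr m_assoc)
qed

lemma free_gen_closed: "i \<in> I \<Longrightarrow> free_gen R i \<in> carrier (free_module R I)"
  by (auto simp: free_gen_def free_module_carrier)

text \<open>Induction on the size of the support: clearing one nonzero value \<open>u i\<close>
  leaves a smaller element, and \<open>u\<close> is recovered by adding back \<open>u i\<close>
  times the generator at \<open>i\<close>.\<close>

lemma free_module_induct [consumes 1, case_names zero step]:
  assumes u: "u \<in> carrier (free_module R I)"
    and zero: "P (\<lambda>i. \<zero>)"
    and step: "\<And>c i v. \<lbrakk>c \<in> carrier R; i \<in> I; v \<in> carrier (free_module R I); P v\<rbrakk> \<Longrightarrow>
      P (\<lambda>j. c \<otimes> free_gen R i j \<oplus> v j)"
  shows "P u"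
  using u
proof (induction "card {i. u i \<noteq> \<zero>}" arbitrary: u)
  case 0
  then have "u = (\<lambda>i. \<zero>)"
    by (auto simp: free_module_carrier)
  then show ?case
    using zero by simp
next
  case (Suc n)
  from Suc.hyps(2) have "{i. u i \<noteq> \<zero>} \<noteq> {}"
    by force
  then obtain i where i: "u i \<noteq> \<zero>"
    by auto
  define v where "v = u(i := \<zero>)"
  have supp: "{j. v j \<noteq> \<zero>} = {j. u j \<noteq> \<zero>} - {i}"
    by (auto simp: v_def)
  have v: "v \<in> carrier (free_module R I)"
    using Suc.prems unfolding free_module_carrier supp by (auto simp: v_def)
  have "card {j. v j \<noteq> \<zero>} = n"
    unfolding supp using Suc.hyps(2) Suc.prems i by (simp add: free_module_carrier)
  then have "P v"
    using Suc.hyps(1) v by metis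
  moreover have "u i \<in> carrier R" "i \<in> I"
    using Suc.prems i by (auto simp: free_module_carrier)
  moreover have "u = (\<lambda>j. u i \<otimes> free_gen R i j \<oplus> v j)"
    using Suc.prems by (auto simp: v_def free_gen_def free_module_carrier)
  ultimately show ?case
    using step v by metis
qed

end

section \<open>Linear extension from generators\<close>

definition free_lift where
  "free_lift K P g u = (\<Oplus>\<^bsub>P\<^esub>i\<in>{i. u i \<noteq> \<zero>\<^bsub>K\<^esub>}. u i \<odot>\<^bsub>P\<^esub> g i)"

context module
begin

text \<open>Sums over different supports cannot be compared as they stand. Any finite subset of
  \<open>I\<close> containing the support may serve as index set instead, since the extra terms are
  zero multiples.\<close>

lemma free_lift_eq:
  assumes "u \<in> carrier (free_module R I)" "g \<in> I \<rightarrow> carrier M"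
    and "finite A" "{i. u i \<noteq> \<zero>} \<subseteq> A" "A \<subseteq> I"
  shows "free_lift R M g u = (\<Oplus>\<^bsub>M\<^esub>i\<in>A. u i \<odot>\<^bsub>M\<^esub> g i)"
  unfolding free_lift_def
  by (rule M.add.finprod_mono_neutral_cong_left)
    (use assms in \<open>auto simp: free_module_carrier Pi_iff subset_iff\<close>)

lemma free_lift_closed:
  assumes "u \<in> carrier (free_module R I)" "g \<in> I \<rightarrow> carrier M"
  shows "free_lift R M g u \<in> carrier M"
  unfolding free_lift_def
  by (rule M.finsum_closed) (use assms in \<open>fastforce simp: free_module_carrier Pi_iff\<close>)

lemma free_lift_add:
  assumes u: "u \<in> carrier (free_module R I)" and v: "v \<in> carrier (free_module R I)"
    and g: "g \<in> I \<rightarrow> carrier M"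
  shows "free_lift R M g (\<lambda>i. u i \<oplus> v i) = free_lift R M g u \<oplus>\<^bsub>M\<^esub> free_lift R M g v"
proof -
  \<comment> \<open>The support of the sum may be smaller than this union because of cancellation;
    the union is an index set common to all three elements.\<close>
  let ?A = "{i. u i \<noteq> \<zero>} \<union> {i. v i \<noteq> \<zero>}"
  have A: "finite ?A" "?A \<subseteq> I"
    using u v by (auto simp: free_module_carrier)
  have cl: "u i \<in> carrier R" "v i \<in> carrier R" for i
    using u v by (auto simp: free_module_carrier)
  have gA: "g i \<in> carrier M" if "i \<in> ?A" for i
    using g A that by blast
  have "free_lift R M g (\<lambda>i. u i \<oplus> v i) = (\<Oplus>\<^bsub>M\<^esub>i\<in>?A. (u i \<oplus> v i) \<odot>\<^bsub>M\<^esub> g i)"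
    by (rule free_lift_eq[OF R.free_module_add_closed[OF u v] g A(1) _ A(2)]) auto
  also have "\<dots> = (\<Oplus>\<^bsub>M\<^esub>i\<in>?A. u i \<odot>\<^bsub>M\<^esub> g i \<oplus>\<^bsub>M\<^esub> v i \<odot>\<^bsub>M\<^esub> g i)"
    by (rule M.finsum_cong') (auto simp: cl gA smult_l_distr)
  also have "\<dots> = (\<Oplus>\<^bsub>M\<^esub>i\<in>?A. u i \<odot>\<^bsub>M\<^esub> g i) \<oplus>\<^bsub>M\<^esub> (\<Oplus>\<^bsub>M\<^esub>i\<in>?A. v i \<odot>\<^bsub>M\<^esub> g i)"
    by (rule M.finsum_addf) (use cl gA in auto)
  also have "\<dots> = free_lift R M g u \<oplus>\<^bsub>M\<^esub> free_lift R M g v"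
    using free_lift_eq[OF u g A(1) _ A(2)] free_lift_eq[OF v g A(1) _ A(2)] by simp
  finally show ?thesis .
qed

lemma free_lift_smult:
  assumes c: "c \<in> carrier R" and u: "u \<in> carrier (free_module R I)" and g: "g \<in> I \<rightarrow> carrier M"
  shows "free_lift R M g (\<lambda>i. c \<otimes> u i) = c \<odot>\<^bsub>M\<^esub> free_lift R M g u"
proof -
  let ?A = "{i. u i \<noteq> \<zero>}"
  have A: "finite ?A" "?A \<subseteq> I"
    using u by (auto simp: free_module_carrier)
  have cl: "u i \<in> carrier R" for i
    using u by (auto simp: free_module_carrier)
  have gA: "g i \<in> carrier M" if "i \<in> ?A" for i
    using g A that by blast
  have "free_lift R M g (\<lambda>i. c \<otimes> u i) = (\<Oplus>\<^bsub>M\<^esub>i\<in>?A. (c \<otimes> u i) \<odot>\<^bsub>M\<^esub> g i)"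
    by (rule free_lift_eq[OF R.free_module_smult_closed[OF c u] g A(1) _ A(2)]) (use c in auto)
  also have "\<dots> = (\<Oplus>\<^bsub>M\<^esub>i\<in>?A. c \<odot>\<^bsub>M\<^esub> (u i \<odot>\<^bsub>M\<^esub> g i))"
    by (rule M.finsum_cong') (use c cl gA in \<open>auto simp: smult_assoc1\<close>)
  also have "\<dots> = c \<odot>\<^bsub>M\<^esub> (\<Oplus>\<^bsub>M\<^esub>i\<in>?A. u i \<odot>\<^bsub>M\<^esub> g i)"
    by (rule finsum_smult_ldistr[symmetric]) (use A c cl gA in auto)
  finally show ?thesis
    by (simp add: free_lift_def)
qed

lemma free_lift_gen:
  assumes "i \<in> I" and g: "g \<in> I \<rightarrow> carrier M"
  shows "free_lift R M g (free_gen R i) = g i"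
proof -
  have gi: "g i \<in> carrier M"
    using assms by auto
  \<comment> \<open>The singleton contains the support of the generator even if one equals zero
    among the scalars, so the degenerate ring needs no separate case.\<close>
  have "free_lift R M g (free_gen R i) = (\<Oplus>\<^bsub>M\<^esub>j\<in>{i}. free_gen R i j \<odot>\<^bsub>M\<^esub> g j)"
    by (rule free_lift_eq[OF R.free_gen_closed g]) (use assms in \<open>auto simp: free_gen_def\<close>)
  also have "\<dots> = g i"
    using gi by (subst M.finsum_insert) (auto simp: free_gen_def)
  finally show ?thesis .
qed

end

section \<open>Quotients by a submodule\<close>

locale quotient_by_submodule = M: module K M + submodule N K M for K M N
begin

abbreviation "Q \<equiv> quotient_module M N"

text \<open>Additively a submodule is a subgroup, which makes the coset calculus of abelian groups
  available; only the scalar action remains to be treated by hand.\<close>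

sublocale abelian_subgroup N M
  by (rule abelian_subgroupI3) (auto intro!: additive_subgroup.intro subgroup_axioms M.abelian_group_axioms)

lemma carrier_quotient: "carrier Q = a_rcosets\<^bsub>M\<^esub> N"
  by (simp add: quotient_module_def)

lemma coset_closed: "x \<in> carrier M \<Longrightarrow> N +>\<^bsub>M\<^esub> x \<in> carrier Q"
  unfolding carrier_quotient by (rule M.a_rcosetsI[OF a_subset])

lemma cosetE:
  assumes "X \<in> carrier Q"
  obtains x where "x \<in> carrier M" "X = N +>\<^bsub>M\<^esub> x"
  using assms unfolding carrier_quotient A_RCOSETS_def' by auto

lemma zero_quotient: "\<zero>\<^bsub>Q\<^esub> = N +>\<^bsub>M\<^esub> \<zero>\<^bsub>M\<^esub>"
  using M.a_coset_add_zero[OF a_subset] by (simp add: quotient_module_def)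

lemma coset_add:
  "\<lbrakk>x \<in> carrier M; y \<in> carrier M\<rbrakk> \<Longrightarrow> (N +>\<^bsub>M\<^esub> x) \<oplus>\<^bsub>Q\<^esub> (N +>\<^bsub>M\<^esub> y) = N +>\<^bsub>M\<^esub> (x \<oplus>\<^bsub>M\<^esub> y)"
  using a_rcos_sum by (simp add: quotient_module_def)

text \<open>This converts an equation between cosets into membership in the submodule, the form in
  which the bilinearity relations are available.\<close>

lemma coset_eq_iff:
  assumes "x \<in> carrier M" "y \<in> carrier M"
  shows "N +>\<^bsub>M\<^esub> x = N +>\<^bsub>M\<^esub> y \<longleftrightarrow> x \<ominus>\<^bsub>M\<^esub> y \<in> N"
  unfolding a_minus_def a_rcos_module[OF assms(2,1), symmetric]
  using a_repr_independence'[OF _ assms(2)] a_repr_independenceD[OF assms(1)] by blast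

text \<open>The action is defined by a union over all representatives. Each differs from
  \<open>x\<close> by some \<open>n\<close> in \<open>N\<close>, and \<open>c\<close> times
  \<open>n\<close> stays in \<open>N\<close>, so the union runs over one and the same coset;
  \<open>x\<close> itself shows that the index set is inhabited.\<close>

lemma coset_smult:
  assumes c: "c \<in> carrier K" and x: "x \<in> carrier M"
  shows "c \<odot>\<^bsub>Q\<^esub> (N +>\<^bsub>M\<^esub> x) = N +>\<^bsub>M\<^esub> (c \<odot>\<^bsub>M\<^esub> x)"
proof -
  have "N +>\<^bsub>M\<^esub> (c \<odot>\<^bsub>M\<^esub> y) = N +>\<^bsub>M\<^esub> (c \<odot>\<^bsub>M\<^esub> x)" if y: "y \<in> N +>\<^bsub>M\<^esub> x" for y
  proof -
    obtain n where n: "n \<in> N" "y = n \<oplus>\<^bsub>M\<^esub> x"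
      using y by (auto simp: a_r_coset_def')
    then have "c \<odot>\<^bsub>M\<^esub> y = c \<odot>\<^bsub>M\<^esub> n \<oplus>\<^bsub>M\<^esub> c \<odot>\<^bsub>M\<^esub> x"
      using c x by (simp add: M.smult_r_distr)
    moreover have "c \<odot>\<^bsub>M\<^esub> n \<in> N"
      using c n by simp
    ultimately have "c \<odot>\<^bsub>M\<^esub> y \<in> N +>\<^bsub>M\<^esub> (c \<odot>\<^bsub>M\<^esub> x)"
      by (auto simp: a_r_coset_def')
    then show ?thesis
      using a_repr_independence'[of "c \<odot>\<^bsub>M\<^esub> y" "c \<odot>\<^bsub>M\<^esub> x"] c x by simp
  qed
  then have "(\<Union>y \<in> N +>\<^bsub>M\<^esub> x. N +>\<^bsub>M\<^esub> (c \<odot>\<^bsub>M\<^esub> y)) = N +>\<^bsub>M\<^esub> (c \<odot>\<^bsub>M\<^esub> x)"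
    using a_rcos_self[OF x] by (intro SUP_eq_const) blast+
  then show ?thesis
    by (simp add: quotient_module_def)
qed

lemma quotient_module_module: "module K Q"
proof -
  note cosets = coset_add coset_smult coset_closed zero_quotient
  have ex: "\<exists>x \<in> carrier M. X = N +>\<^bsub>M\<^esub> x" if "X \<in> carrier Q" for X
    using that by (rule cosetE) blast
  have "abelian_group Q"
  proof (rule abelian_groupI)
    show "X \<oplus>\<^bsub>Q\<^esub> Y \<in> carrier Q" "X \<oplus>\<^bsub>Q\<^esub> Y = Y \<oplus>\<^bsub>Q\<^esub> X"
      if *: "X \<in> carrier Q" "Y \<in> carrier Q" for X Y
    proof -
      obtain x y where "x \<in> carrier M" "X = N +>\<^bsub>M\<^esub> x" "y \<in> carrier M" "Y = N +>\<^bsub>M\<^esub> y"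
        using ex[OF *(1)] ex[OF *(2)] by blast
      then show "X \<oplus>\<^bsub>Q\<^esub> Y \<in> carrier Q" "X \<oplus>\<^bsub>Q\<^esub> Y = Y \<oplus>\<^bsub>Q\<^esub> X"
        by (simp_all add: cosets M.a_comm)
    qed
    show "X \<oplus>\<^bsub>Q\<^esub> Y \<oplus>\<^bsub>Q\<^esub> W = X \<oplus>\<^bsub>Q\<^esub> (Y \<oplus>\<^bsub>Q\<^esub> W)"
      if *: "X \<in> carrier Q" "Y \<in> carrier Q" "W \<in> carrier Q" for X Y W
    proof -
      obtain x y w where "x \<in> carrier M" "X = N +>\<^bsub>M\<^esub> x" "y \<in> carrier M" "Y = N +>\<^bsub>M\<^esub> y"
        "w \<in> carrier M" "W = N +>\<^bsub>M\<^esub> w"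
        using ex[OF *(1)] ex[OF *(2)] ex[OF *(3)] by blast
      then show ?thesis
        by (simp add: cosets M.a_assoc)
    qed
    show "\<zero>\<^bsub>Q\<^esub> \<oplus>\<^bsub>Q\<^esub> X = X" if "X \<in> carrier Q" for X
      using ex[OF that] by (auto simp: cosets)
  next
    show "\<zero>\<^bsub>Q\<^esub> \<in> carrier Q"
      by (simp add: cosets)
  next
    fix X assume "X \<in> carrier Q"
    then obtain x where x: "x \<in> carrier M" "X = N +>\<^bsub>M\<^esub> x"
      by (rule cosetE)
    show "\<exists>Y \<in> carrier Q. Y \<oplus>\<^bsub>Q\<^esub> X = \<zero>\<^bsub>Q\<^esub>"
      by (rule bexI[where x = "N +>\<^bsub>M\<^esub> (\<ominus>\<^bsub>M\<^esub> x)"]) (use x in \<open>simp_all add: cosets M.l_neg\<close>)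
  qed
  then show ?thesis
  proof (rule moduleI[OF M.R.is_cring])
    show "c \<odot>\<^bsub>Q\<^esub> X \<in> carrier Q" if "c \<in> carrier K" "X \<in> carrier Q" for c X
      using ex[OF that(2)] that(1) by (auto simp: cosets)
    show "(c \<oplus>\<^bsub>K\<^esub> d) \<odot>\<^bsub>Q\<^esub> X = c \<odot>\<^bsub>Q\<^esub> X \<oplus>\<^bsub>Q\<^esub> d \<odot>\<^bsub>Q\<^esub> X"
      "(c \<otimes>\<^bsub>K\<^esub> d) \<odot>\<^bsub>Q\<^esub> X = c \<odot>\<^bsub>Q\<^esub> (d \<odot>\<^bsub>Q\<^esub> X)"
      if "c \<in> carrier K" "d \<in> carrier K" "X \<in> carrier Q" for c d X
      using ex[OF that(3)] that(1,2) by (auto simp: cosets M.smult_l_distr M.smult_assoc1)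
    show "c \<odot>\<^bsub>Q\<^esub> (X \<oplus>\<^bsub>Q\<^esub> Y) = c \<odot>\<^bsub>Q\<^esub> X \<oplus>\<^bsub>Q\<^esub> c \<odot>\<^bsub>Q\<^esub> Y"
      if *: "c \<in> carrier K" "X \<in> carrier Q" "Y \<in> carrier Q" for c X Y
    proof -
      obtain x y where "x \<in> carrier M" "X = N +>\<^bsub>M\<^esub> x" "y \<in> carrier M" "Y = N +>\<^bsub>M\<^esub> y"
        using ex[OF *(2)] ex[OF *(3)] by blast
      with *(1) show ?thesis
        by (simp add: cosets M.smult_r_distr)
    qed
    show "\<one>\<^bsub>K\<^esub> \<odot>\<^bsub>Q\<^esub> X = X" if "X \<in> carrier Q" for X
      using ex[OF that] by (auto simp: cosets)
  qed
qed

end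

text \<open>Nonemptiness is what confines the intersection to the carrier; over the empty family it
  would be the whole type.\<close>

lemma (in module) submodule_Inter:
  assumes "\<U> \<noteq> {}" "\<And>U. U \<in> \<U> \<Longrightarrow> submodule U R M"
  shows "submodule (\<Inter>\<U>) R M"
proof (rule submoduleI)
  obtain U where "U \<in> \<U>"
    using assms(1) by blast
  then show "\<Inter>\<U> \<subseteq> carrier M"
    using submoduleE(1)[OF assms(2)] by blast
  have "\<zero>\<^bsub>M\<^esub> \<in> U" if "U \<in> \<U>" for U
    using subgroup.one_closed[OF submodule.axioms(1)[OF assms(2)[OF that]]] by simp
  then show "\<zero>\<^bsub>M\<^esub> \<in> \<Inter>\<U>"
    by blast
  show "\<ominus>\<^bsub>M\<^esub> a \<in> \<Inter>\<U>" if "a \<in> \<Inter>\<U>" for a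
    using that submoduleE(3)[OF assms(2)] by blast
  show "a \<oplus>\<^bsub>M\<^esub> b \<in> \<Inter>\<U>" if "a \<in> \<Inter>\<U>" "b \<in> \<Inter>\<U>" for a b
    using that submoduleE(5)[OF assms(2)] by blast
  show "c \<odot>\<^bsub>M\<^esub> a \<in> \<Inter>\<U>" if "c \<in> carrier R" "a \<in> \<Inter>\<U>" for c a
    using that submoduleE(4)[OF assms(2)] by blast
qed

section \<open>Tensor products\<close>

locale tensor_product = M: module K M + N: module K N for K M N
begin

abbreviation "F \<equiv> free_module K (carrier M \<times> carrier N)"
abbreviation "Z \<equiv> tensor_kernel K M N"
abbreviation "T \<equiv> tensor K M N"
abbreviation "pt \<equiv> pure_tensor K M N"
abbreviation "e x y \<equiv> free_gen K (x, y)"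

sublocale F: module K F
  by (rule M.free_module_module)

lemma gen_closed: "\<lbrakk>x \<in> carrier M; y \<in> carrier N\<rbrakk> \<Longrightarrow> e x y \<in> carrier F"
  by (simp add: M.free_gen_closed)

lemma tensor_relations_subset: "tensor_relations K M N \<subseteq> carrier F"
proof -
  \<comment> \<open>Unfolded pointwise, the operations of \<open>F\<close> would no longer match the
    closure rules of an abstract module.\<close>
  note [simp del] = free_module_simps
  show ?thesis
    unfolding tensor_relations_def Let_def by (auto intro!: gen_closed)
qed

lemma tensor_relations_kernel: "tensor_relations K M N \<subseteq> Z"
  unfolding tensor_kernel_def by auto

text \<open>The way to show that a linear map kills \<open>Z\<close>: its zero set is a submodule,
  so only the defining relations have to be tested.\<close>

lemma tensor_kernel_least:
  assumes "submodule U K F" "tensor_relations K M N \<subseteq> U"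
  shows "Z \<subseteq> U"
  using assms unfolding tensor_kernel_def by blast

lemma tensor_kernel_submodule: "submodule Z K F"
  unfolding tensor_kernel_def
  by (rule F.submodule_Inter) (use F.carrier_is_submodule tensor_relations_subset in auto)

sublocale Z: quotient_by_submodule K F Z
  by (intro quotient_by_submodule.intro tensor_kernel_submodule F.module_axioms)

lemma tensor_module: "module K T"
  unfolding tensor_def by (rule Z.quotient_module_module)

sublocale T: module K T
  by (rule tensor_module)

lemma pure_tensor_closed: "\<lbrakk>x \<in> carrier M; y \<in> carrier N\<rbrakk> \<Longrightarrow> pt x y \<in> carrier T"
  unfolding tensor_def pure_tensor_def by (rule Z.coset_closed) (rule gen_closed)

text \<open>Each of the four bilinearity laws is one of the four families of relations, read modulo
  \<open>Z\<close>.\<close>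

lemma pure_tensor_bilinear: "bilinear_map K M N T pt"
proof -
  note [simp del] = free_module_simps
  note rel = subsetD[OF tensor_relations_kernel]
  show ?thesis
  proof (rule bilinear_mapI)
    fix x x' y assume *: "x \<in> carrier M" "x' \<in> carrier M" "y \<in> carrier N"
    then have "e (x \<oplus>\<^bsub>M\<^esub> x') y \<ominus>\<^bsub>F\<^esub> (e x y \<oplus>\<^bsub>F\<^esub> e x' y) \<in> Z"
      by (intro rel) (auto simp: tensor_relations_def Let_def)
    then show "pt (x \<oplus>\<^bsub>M\<^esub> x') y = pt x y \<oplus>\<^bsub>T\<^esub> pt x' y"
      unfolding tensor_def pure_tensor_def using * by (simp add: Z.coset_add Z.coset_eq_iff gen_closed)
  next
    fix x y y' assume *: "x \<in> carrier M" "y \<in> carrier N" "y' \<in> carrier N"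
    then have "e x (y \<oplus>\<^bsub>N\<^esub> y') \<ominus>\<^bsub>F\<^esub> (e x y \<oplus>\<^bsub>F\<^esub> e x y') \<in> Z"
      by (intro rel) (auto simp: tensor_relations_def Let_def)
    then show "pt x (y \<oplus>\<^bsub>N\<^esub> y') = pt x y \<oplus>\<^bsub>T\<^esub> pt x y'"
      unfolding tensor_def pure_tensor_def using * by (simp add: Z.coset_add Z.coset_eq_iff gen_closed)
  next
    fix c x y assume *: "c \<in> carrier K" "x \<in> carrier M" "y \<in> carrier N"
    then have "e (c \<odot>\<^bsub>M\<^esub> x) y \<ominus>\<^bsub>F\<^esub> c \<odot>\<^bsub>F\<^esub> e x y \<in> Z"
      by (intro rel) (auto simp: tensor_relations_def Let_def)
    then show "pt (c \<odot>\<^bsub>M\<^esub> x) y = c \<odot>\<^bsub>T\<^esub> pt x y"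
      unfolding tensor_def pure_tensor_def using * by (simp add: Z.coset_smult Z.coset_eq_iff gen_closed)
  next
    fix c x y assume *: "c \<in> carrier K" "x \<in> carrier M" "y \<in> carrier N"
    then have "e x (c \<odot>\<^bsub>N\<^esub> y) \<ominus>\<^bsub>F\<^esub> c \<odot>\<^bsub>F\<^esub> e x y \<in> Z"
      by (intro rel) (auto simp: tensor_relations_def Let_def)
    then show "pt x (c \<odot>\<^bsub>N\<^esub> y) = c \<odot>\<^bsub>T\<^esub> pt x y"
      unfolding tensor_def pure_tensor_def using * by (simp add: Z.coset_smult Z.coset_eq_iff gen_closed)
  qed (rule pure_tensor_closed)
qed

text \<open>A tensor is the coset of a finite combination of generators, and the coset of a
  generator is a pure tensor, so induction on the free module carries over.\<close>

lemma tensor_induct [consumes 1, case_names pure add smult]: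
  assumes t: "t \<in> carrier T"
    and pure: "\<And>x y. \<lbrakk>x \<in> carrier M; y \<in> carrier N\<rbrakk> \<Longrightarrow> P (pt x y)"
    and add: "\<And>s t. \<lbrakk>s \<in> carrier T; t \<in> carrier T; P s; P t\<rbrakk> \<Longrightarrow> P (s \<oplus>\<^bsub>T\<^esub> t)"
    and smult: "\<And>c t. \<lbrakk>c \<in> carrier K; t \<in> carrier T; P t\<rbrakk> \<Longrightarrow> P (c \<odot>\<^bsub>T\<^esub> t)"
  shows "P t"
proof -
  obtain u where u: "u \<in> carrier F" "t = Z +>\<^bsub>F\<^esub> u"
    using t unfolding tensor_def by (rule Z.cosetE)
  have "P (Z +>\<^bsub>F\<^esub> u)"
    using u(1)
  proof (induction u rule: M.free_module_induct)
    case zero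
    \<comment> \<open>No zero case is assumed: the zero tensor is the scalar zero times the pure
      tensor of the two zeros.\<close>
    have "P (\<zero>\<^bsub>K\<^esub> \<odot>\<^bsub>T\<^esub> pt \<zero>\<^bsub>M\<^esub> \<zero>\<^bsub>N\<^esub>)"
      by (intro smult pure pure_tensor_closed) auto
    moreover have "\<zero>\<^bsub>K\<^esub> \<odot>\<^bsub>T\<^esub> pt \<zero>\<^bsub>M\<^esub> \<zero>\<^bsub>N\<^esub> = \<zero>\<^bsub>T\<^esub>"
      by (intro T.smult_l_null pure_tensor_closed) auto
    ultimately show ?case
      using Z.zero_quotient by (simp add: tensor_def)
  next
    case (step c i v)
    then obtain x y where xy: "x \<in> carrier M" "y \<in> carrier N" "i = (x, y)"
      by auto
    have "P (c \<odot>\<^bsub>T\<^esub> pt x y \<oplus>\<^bsub>T\<^esub> (Z +>\<^bsub>F\<^esub> v))"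
      using step xy Z.coset_closed[of v]
      by (intro add smult pure pure_tensor_closed T.smult_closed) (auto simp: tensor_def)
    moreover have "c \<odot>\<^bsub>T\<^esub> pt x y \<oplus>\<^bsub>T\<^esub> (Z +>\<^bsub>F\<^esub> v) =
        Z +>\<^bsub>F\<^esub> (c \<odot>\<^bsub>F\<^esub> e x y \<oplus>\<^bsub>F\<^esub> v)"
      unfolding tensor_def pure_tensor_def using step xy
      by (simp add: Z.coset_smult Z.coset_add gen_closed del: free_module_simps)
    ultimately show ?case
      using xy by simp
  qed
  with u show ?thesis
    by simp
qed

text \<open>This replaces Sweedler notation: pure tensors span, so two linear expressions in
  \<open>t\<close> that agree on them agree at \<open>\<Delta> x\<close> as well.\<close>

lemma tensor_eqI:
  assumes "is_linear K T P g" "is_linear K T P h"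
    and "\<And>x y. \<lbrakk>x \<in> carrier M; y \<in> carrier N\<rbrakk> \<Longrightarrow> g (pt x y) = h (pt x y)"
    and "t \<in> carrier T"
  shows "g t = h t"
  using assms(4)
  by (induction rule: tensor_induct) (simp_all add: assms(3) is_linearD[OF assms(1)] is_linearD[OF assms(2)])

text \<open>By minimality of \<open>Z\<close> it suffices that the zero set of the linear extension
  of \<open>b\<close> is a submodule containing the relations, and each relation is sent to zero by
  one of the bilinearity laws of \<open>b\<close>.\<close>

lemma free_lift_kernel:
  assumes P: "module K P" and b: "bilinear_map K M N P b"
  shows "Z \<subseteq> {u \<in> carrier F. free_lift K P (case_prod b) u = \<zero>\<^bsub>P\<^esub>}"
proof (rule tensor_kernel_least)
  interpret P: module K P by fact
  let ?l = "free_lift K P (case_prod b)"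
  have g: "case_prod b \<in> carrier M \<times> carrier N \<rightarrow> carrier P"
    using bilinear_mapD(1)[OF b] by auto
  note [simp del] = free_module_simps
  have add: "?l (u \<oplus>\<^bsub>F\<^esub> v) = ?l u \<oplus>\<^bsub>P\<^esub> ?l v" if "u \<in> carrier F" "v \<in> carrier F" for u v
    using P.free_lift_add[OF that g] by (simp add: free_module_simps)
  have smult: "?l (c \<odot>\<^bsub>F\<^esub> u) = c \<odot>\<^bsub>P\<^esub> ?l u" if "c \<in> carrier K" "u \<in> carrier F" for c u
    using P.free_lift_smult[OF that g] by (simp add: free_module_simps)
  have closed: "?l u \<in> carrier P" if "u \<in> carrier F" for u
    using P.free_lift_closed[OF that g] .
  have gen: "?l (e x y) = b x y" if "x \<in> carrier M" "y \<in> carrier N" for x y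
    using P.free_lift_gen[OF _ g] that by simp
  have zero: "?l \<zero>\<^bsub>F\<^esub> = \<zero>\<^bsub>P\<^esub>"
    using smult[of "\<zero>\<^bsub>K\<^esub>" "\<zero>\<^bsub>F\<^esub>"] closed[of "\<zero>\<^bsub>F\<^esub>"] by simp
  have minus: "?l (\<ominus>\<^bsub>F\<^esub> u) = \<ominus>\<^bsub>P\<^esub> ?l u" if "u \<in> carrier F" for u
    using add[of u "\<ominus>\<^bsub>F\<^esub> u"] that zero closed
    by (metis F.M.add.inv_closed F.M.r_neg P.M.add.inv_equality P.M.a_comm)
  have diff: "?l (u \<ominus>\<^bsub>F\<^esub> v) = ?l u \<ominus>\<^bsub>P\<^esub> ?l v" if "u \<in> carrier F" "v \<in> carrier F" for u v
    using that by (simp add: a_minus_def add minus)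
  show "submodule {u \<in> carrier F. ?l u = \<zero>\<^bsub>P\<^esub>} K F"
    by (rule F.submoduleI) (auto simp: zero minus add smult)
  note [simp] = gen_closed diff add smult gen bilinear_mapD[OF b] P.r_neg
  show "tensor_relations K M N \<subseteq> {u \<in> carrier F. ?l u = \<zero>\<^bsub>P\<^esub>}"
    unfolding tensor_relations_def Let_def by (auto simp: a_minus_def[of P])
qed

lemma tensor_lift_ex:
  assumes P: "module K P" and b: "bilinear_map K M N P b"
  shows "\<exists>h. h \<in> linear_maps K T P \<and> (\<forall>x \<in> carrier M. \<forall>y \<in> carrier N. h (pt x y) = b x y)"
proof -
  interpret P: module K P by fact
  let ?l = "free_lift K P (case_prod b)"
  have g: "case_prod b \<in> carrier M \<times> carrier N \<rightarrow> carrier P"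
    using bilinear_mapD(1)[OF b] by auto
  \<comment> \<open>Two representatives differ by an element \<open>w\<close> of \<open>Z\<close>,
    which the extension sends to zero.\<close>
  have wd: "?l u = ?l v" if "u \<in> carrier F" "v \<in> carrier F" "Z +>\<^bsub>F\<^esub> u = Z +>\<^bsub>F\<^esub> v" for u v
  proof -
    define w where "w = u \<ominus>\<^bsub>F\<^esub> v"
    have w: "w \<in> carrier F" "?l w = \<zero>\<^bsub>P\<^esub>"
      using that free_lift_kernel[OF P b] by (auto simp: Z.coset_eq_iff w_def)
    have "u = w \<oplus>\<^bsub>F\<^esub> v"
      using that F.M.minus_add[of u v] unfolding w_def a_minus_def
      by (simp add: F.M.a_assoc F.M.l_neg del: free_module_simps)
    then have "?l u = ?l w \<oplus>\<^bsub>P\<^esub> ?l v"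
      using P.free_lift_add[OF w(1) that(2) g] by simp
    then show ?thesis
      using w P.free_lift_closed[OF that(2) g] by simp
  qed
  \<comment> \<open>The value is read off a chosen representative; restricting to the carrier
    supplies the extensionality that \<open>linear_maps\<close> demands.\<close>
  define h where "h = (\<lambda>X \<in> carrier T. ?l (SOME u. u \<in> carrier F \<and> X = Z +>\<^bsub>F\<^esub> u))"
  have h: "h (Z +>\<^bsub>F\<^esub> u) = ?l u" if u: "u \<in> carrier F" for u
  proof -
    have "Z +>\<^bsub>F\<^esub> u \<in> carrier T"
      using Z.coset_closed[OF u] by (simp add: tensor_def)
    moreover have "?l (SOME v. v \<in> carrier F \<and> Z +>\<^bsub>F\<^esub> u = Z +>\<^bsub>F\<^esub> v) = ?l u"
      by (rule someI2[of _ u], simp add: u) (intro wd, simp_all add: u)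
    ultimately show ?thesis
      by (simp add: h_def)
  qed
  have "is_linear K T P h"
  proof (rule is_linearI)
    fix X assume "X \<in> carrier T"
    then show "h X \<in> carrier P"
      unfolding tensor_def by (elim Z.cosetE) (simp add: h P.free_lift_closed[OF _ g])
  next
    fix X Y assume "X \<in> carrier T" "Y \<in> carrier T"
    then show "h (X \<oplus>\<^bsub>T\<^esub> Y) = h X \<oplus>\<^bsub>P\<^esub> h Y"
      unfolding tensor_def
      by (elim Z.cosetE) (simp add: Z.coset_add h P.free_lift_add[OF _ _ g] M.free_module_add_closed)
  next
    fix c X assume "c \<in> carrier K" "X \<in> carrier T"
    then show "h (c \<odot>\<^bsub>T\<^esub> X) = c \<odot>\<^bsub>P\<^esub> h X"
      unfolding tensor_def
      by (elim Z.cosetE) (simp add: Z.coset_smult h P.free_lift_smult[OF _ _ g] M.free_module_smult_closed)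
  qed
  then have "h \<in> linear_maps K T P"
    by (simp add: linear_maps_iff h_def)
  moreover have "h (pt x y) = b x y" if "x \<in> carrier M" "y \<in> carrier N" for x y
    unfolding pure_tensor_def using that P.free_lift_gen[OF _ g] by (simp add: h gen_closed)
  ultimately show ?thesis
    by blast
qed

text \<open>\<open>tensor_lift\<close> is a definite description, so uniqueness is needed too:
  agreement on pure tensors forces agreement on the carrier, and both candidates are
  \<open>undefined\<close> elsewhere.\<close>

lemma tensor_lift:
  assumes P: "module K P" and b: "bilinear_map K M N P b"
  shows tensor_lift_linear: "is_linear K T P (tensor_lift K M N P b)"
    and tensor_lift_pure: "\<And>x y. \<lbrakk>x \<in> carrier M; y \<in> carrier N\<rbrakk> \<Longrightarrow> tensor_lift K M N P b (pt x y) = b x y"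
proof -
  have "\<exists>!h. h \<in> linear_maps K T P \<and> (\<forall>x \<in> carrier M. \<forall>y \<in> carrier N. h (pt x y) = b x y)"
  proof (rule ex_ex1I[OF tensor_lift_ex[OF P b]])
    fix g h
    assume g: "g \<in> linear_maps K T P \<and> (\<forall>x \<in> carrier M. \<forall>y \<in> carrier N. g (pt x y) = b x y)"
      and h: "h \<in> linear_maps K T P \<and> (\<forall>x \<in> carrier M. \<forall>y \<in> carrier N. h (pt x y) = b x y)"
    show "g = h"
    proof (rule extensionalityI)
      fix t assume "t \<in> carrier T"
      then show "g t = h t"
        by (rule tensor_eqI[rotated 3]) (use g h in \<open>auto simp: linear_maps_iff\<close>)
    qed (use g h in \<open>auto simp: linear_maps_iff\<close>)
  qed
  from theI'[OF this] show "is_linear K T P (tensor_lift K M N P b)"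
    and "\<And>x y. \<lbrakk>x \<in> carrier M; y \<in> carrier N\<rbrakk> \<Longrightarrow> tensor_lift K M N P b (pt x y) = b x y"
    unfolding tensor_lift_def linear_maps_iff by auto
qed

text \<open>Nested lifts, as in the associators and in \<open>ad\<close>, need the inner lift to be
  linear in the outer variable \<open>z\<close>. For a pure \<open>t\<close> this is linearity of
  \<open>b\<close> in \<open>z\<close>, and linear functions of \<open>z\<close> are closed under
  sums and scalar multiples, so it extends to all \<open>t\<close> by induction.\<close>

lemma tensor_lift_parameter_linear:
  assumes P: "module K P" and Q: "module K Q"
    and b: "\<And>z. z \<in> carrier Q \<Longrightarrow> bilinear_map K M N P (b z)"
    and lin: "\<And>x y. \<lbrakk>x \<in> carrier M; y \<in> carrier N\<rbrakk> \<Longrightarrow> is_linear K Q P (\<lambda>z. b z x y)"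
    and t: "t \<in> carrier T"
  shows "is_linear K Q P (\<lambda>z. tensor_lift K M N P (b z) t)"
  using t
proof (induction rule: tensor_induct)
  case (pure x y)
  show ?case
    by (rule is_linear_cong[OF Q lin[OF pure]]) (simp add: tensor_lift_pure[OF P b] pure)
next
  case (add s t)
  show ?case
    by (rule is_linear_cong[OF Q is_linear_plus[OF P add(3,4)]])
      (simp add: is_linear_add[OF tensor_lift_linear[OF P b]] add)
next
  case (smult c t)
  show ?case
    by (rule is_linear_cong[OF Q is_linear_smult_comp[OF P smult(1,3)]])
      (simp add: is_linear_smult[OF tensor_lift_linear[OF P b]] smult)
qed

end

section \<open>Functoriality, symmetry and associativity of the tensor product\<close>

lemmas tensor_module = tensor_product.tensor_module[OF tensor_product.intro]
lemmas pure_tensor_closed = tensor_product.pure_tensor_closed[OF tensor_product.intro]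
lemmas pure_tensor_bilinear = tensor_product.pure_tensor_bilinear[OF tensor_product.intro]
lemmas tensor_eqI = tensor_product.tensor_eqI[OF tensor_product.intro]
lemmas tensor_lift_linear = tensor_product.tensor_lift_linear[OF tensor_product.intro]
lemmas tensor_lift_pure = tensor_product.tensor_lift_pure[OF tensor_product.intro]
lemmas tensor_lift_parameter_linear =
  tensor_product.tensor_lift_parameter_linear[OF tensor_product.intro]

lemma tensor_map:
  assumes M: "module K M" "module K N" "module K M'" "module K N'"
    and fg: "is_linear K M M' f" "is_linear K N N' g"
  shows tensor_map_linear:
      "is_linear K (tensor K M N) (tensor K M' N') (tensor_map K M N M' N' f g)"
    and tensor_map_pure:
      "\<And>x y. \<lbrakk>x \<in> carrier M; y \<in> carrier N\<rbrakk> \<Longrightarrow>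
        tensor_map K M N M' N' f g (pure_tensor K M N x y) = pure_tensor K M' N' (f x) (g y)"
proof -
  have b: "bilinear_map K M N (tensor K M' N') (\<lambda>x y. pure_tensor K M' N' (f x) (g y))"
    by (rule bilinear_map_comp[OF pure_tensor_bilinear fg]) fact+
  show "is_linear K (tensor K M N) (tensor K M' N') (tensor_map K M N M' N' f g)"
    unfolding tensor_map_def using M b by (intro tensor_lift_linear tensor_module)
  show "tensor_map K M N M' N' f g (pure_tensor K M N x y) = pure_tensor K M' N' (f x) (g y)"
    if "x \<in> carrier M" "y \<in> carrier N" for x y
    unfolding tensor_map_def using M b that by (intro tensor_lift_pure tensor_module)
qed

lemma tensor_swap_linear:
  assumes M: "module K M" "module K N"
  shows "is_linear K (tensor K M N) (tensor K N M) (tensor_swap K M N)"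
proof -
  have "bilinear_map K M N (tensor K N M) (\<lambda>x y. pure_tensor K N M y x)"
    using pure_tensor_bilinear[OF M(2,1)] by (simp add: bilinear_map_iff)
  then show ?thesis
    unfolding tensor_swap_def using M by (intro tensor_lift_linear tensor_module)
qed

text \<open>For fixed \<open>z\<close> the inner lift comes from a bilinear map in \<open>x\<close>
  and \<open>y\<close>; the outer lift exists because that inner lift depends linearly on
  \<open>z\<close>.\<close>

lemma tensor_assoc:
  assumes M: "module K M" "module K N" "module K P"
  shows tensor_assoc_linear:
      "is_linear K (tensor K (tensor K M N) P) (tensor K M (tensor K N P)) (tensor_assoc K M N P)"
    and tensor_assoc_pure:
      "\<And>x y z. \<lbrakk>x \<in> carrier M; y \<in> carrier N; z \<in> carrier P\<rbrakk> \<Longrightarrow>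
        tensor_assoc K M N P (pure_tensor K (tensor K M N) P (pure_tensor K M N x y) z) =
        pure_tensor K M (tensor K N P) x (pure_tensor K N P y z)"
proof -
  let ?X = "tensor K M (tensor K N P)"
  let ?b = "\<lambda>z x y. pure_tensor K M (tensor K N P) x (pure_tensor K N P y z)"
  let ?l = "\<lambda>t z. tensor_lift K M N ?X (?b z) t"
  note T = tensor_module[OF M(1,2)] tensor_module[OF M(2,3)]
  note X = tensor_module[OF M(1) T(2)]
  have bz: "bilinear_map K M N ?X (?b z)" if "z \<in> carrier P" for z
    using that M T
    by (intro bilinear_map_comp[OF pure_tensor_bilinear is_linear_id]
        bilinear_map_left[OF pure_tensor_bilinear])
  have lin: "is_linear K P ?X (\<lambda>z. ?b z x y)" if "x \<in> carrier M" "y \<in> carrier N" for x y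
    using that M T
    by (intro is_linear_comp[OF bilinear_map_right[OF pure_tensor_bilinear]]
        bilinear_map_right[OF pure_tensor_bilinear])
  have b: "bilinear_map K (tensor K M N) P ?X ?l"
    unfolding bilinear_map_iff
    using M X bz lin by (auto intro!: tensor_lift_linear tensor_lift_parameter_linear)
  show "is_linear K (tensor K (tensor K M N) P) ?X (tensor_assoc K M N P)"
    unfolding tensor_assoc_def by (rule tensor_lift_linear[OF T(1) M(3) X b])
  fix x y z assume xyz: "x \<in> carrier M" "y \<in> carrier N" "z \<in> carrier P"
  then have "tensor_assoc K M N P (pure_tensor K (tensor K M N) P (pure_tensor K M N x y) z) =
      ?l (pure_tensor K M N x y) z"
    unfolding tensor_assoc_def
    by (intro tensor_lift_pure[OF T(1) M(3) X b] pure_tensor_closed M)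
  also have "\<dots> = ?b z x y"
    using xyz by (intro tensor_lift_pure[OF M(1,2) X bz])
  finally show "tensor_assoc K M N P (pure_tensor K (tensor K M N) P (pure_tensor K M N x y) z) =
      ?b z x y" .
qed

lemma tensor_assoc_inv_linear:
  assumes M: "module K M" "module K N" "module K P"
  shows "is_linear K (tensor K M (tensor K N P)) (tensor K (tensor K M N) P) (tensor_assoc_inv K M N P)"
proof -
  let ?X = "tensor K (tensor K M N) P"
  let ?b = "\<lambda>x y z. pure_tensor K (tensor K M N) P (pure_tensor K M N x y) z"
  note T = tensor_module[OF M(1,2)] tensor_module[OF M(2,3)]
  note X = tensor_module[OF T(1) M(3)]
  have bx: "bilinear_map K N P ?X (?b x)" if "x \<in> carrier M" for x
    using that M T
    by (intro bilinear_map_comp[OF pure_tensor_bilinear _ is_linear_id]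
        bilinear_map_right[OF pure_tensor_bilinear])
  have lin: "is_linear K M ?X (\<lambda>x. ?b x y z)" if "y \<in> carrier N" "z \<in> carrier P" for y z
    using that M T
    by (intro is_linear_comp[OF bilinear_map_left[OF pure_tensor_bilinear]]
        bilinear_map_left[OF pure_tensor_bilinear])
  have b: "bilinear_map K M (tensor K N P) ?X (\<lambda>x. tensor_lift K N P ?X (?b x))"
    unfolding bilinear_map_iff
    using M X bx lin by (auto intro!: tensor_lift_linear tensor_lift_parameter_linear)
  show ?thesis
    unfolding tensor_assoc_inv_def by (rule tensor_lift_linear[OF M(1) T(2) X b])
qed

text \<open>On a pure tensor the left factor becomes zero, and linearity in the left slot makes the
  result vanish. This disposes of the terms of \<open>D2\<close> in which the zero cochain is a
  tensor factor on the left.\<close>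

lemma tensor_map_zero_left:
  assumes M: "module K M" "module K N" "module K M'" "module K N'"
    and f: "\<And>x. x \<in> carrier M \<Longrightarrow> f x = \<zero>\<^bsub>M'\<^esub>" and g: "is_linear K N N' g"
    and t: "t \<in> carrier (tensor K M N)"
  shows "tensor_map K M N M' N' f g t = \<zero>\<^bsub>tensor K M' N'\<^esub>"
proof -
  have f': "is_linear K M M' f"
    by (rule is_linear_cong[OF M(1) is_linear_const_zero[OF M(3)] f])
  note fg = tensor_map[OF M f' g]
  show ?thesis
  proof (rule tensor_eqI[OF M(1,2) fg(1) is_linear_const_zero[OF tensor_module[OF M(3,4)]] _ t])
    fix x y assume xy: "x \<in> carrier M" "y \<in> carrier N"
    then have "is_linear K M' (tensor K M' N') (\<lambda>z. pure_tensor K M' N' z (g y))"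
      using M by (intro bilinear_map_left[OF pure_tensor_bilinear] is_linear_closed[OF g])
    from is_linear_zero[OF this M(3) tensor_module[OF M(3,4)]]
    show "tensor_map K M N M' N' f g (pure_tensor K M N x y) = \<zero>\<^bsub>tensor K M' N'\<^esub>"
      using xy by (simp add: fg f)
  qed
qed

lemma tensor_map_zero_right:
  assumes M: "module K M" "module K N" "module K M'" "module K N'"
    and f: "is_linear K M M' f" and g: "\<And>y. y \<in> carrier N \<Longrightarrow> g y = \<zero>\<^bsub>N'\<^esub>"
    and t: "t \<in> carrier (tensor K M N)"
  shows "tensor_map K M N M' N' f g t = \<zero>\<^bsub>tensor K M' N'\<^esub>"
proof -
  have g': "is_linear K N N' g"
    by (rule is_linear_cong[OF M(2) is_linear_const_zero[OF M(4)] g])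
  note fg = tensor_map[OF M f g']
  show ?thesis
  proof (rule tensor_eqI[OF M(1,2) fg(1) is_linear_const_zero[OF tensor_module[OF M(3,4)]] _ t])
    fix x y assume xy: "x \<in> carrier M" "y \<in> carrier N"
    then have "is_linear K N' (tensor K M' N') (pure_tensor K M' N' (f x))"
      using M by (intro bilinear_map_right[OF pure_tensor_bilinear] is_linear_closed[OF f])
    from is_linear_zero[OF this M(4) tensor_module[OF M(3,4)]]
    show "tensor_map K M N M' N' f g (pure_tensor K M N x y) = \<zero>\<^bsub>tensor K M' N'\<^esub>"
      using xy by (simp add: fg g)
  qed
qed

section \<open>Hopf algebras\<close>

context hopf_algebra
begin

text \<open>Unfolding an eta-expanded identity map would block the rewriting of tensor maps.\<close>

declare restrict_apply [simp del] restrict_apply' [simp]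

abbreviation "tm \<equiv> tensor_map K H H H H"
abbreviation "pt \<equiv> pure_tensor K H H"
abbreviation "B \<equiv> base_module K"

lemma H_module: "module K H" ..

lemma B_module: "module K B"
  by (rule base_module_module) (rule K.is_cring)

lemma HH_module: "module K HH"
  and HH_H_module: "module K HH_H"
  and H_HH_module: "module K H_HH"
  and H_H_HH_module: "module K H_H_HH"
  and HH_HH_module: "module K HH_HH"
  by (intro tensor_module H_module)+

lemmas modules = H_module B_module HH_module HH_H_module H_HH_module H_H_HH_module HH_HH_module

lemma mult_bilinear: "bilinear_map K H H H (\<lambda>x y. x \<otimes>\<^bsub>H\<^esub> y)"
  by (rule bilinear_mapI) (simp_all add: H.l_distr H.r_distr smult_mult_left smult_mult_right)

lemma mu_linear: "is_linear K HH H \<mu>"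
  unfolding \<mu>_def by (intro tensor_lift_linear modules mult_bilinear)

lemma mu_pure: "\<lbrakk>x \<in> carrier H; y \<in> carrier H\<rbrakk> \<Longrightarrow> \<mu> (pt x y) = x \<otimes>\<^bsub>H\<^esub> y"
  unfolding \<mu>_def by (intro tensor_lift_pure modules mult_bilinear)

lemma one_linear: "is_linear K H H one_H"
  by (intro is_linear_restrict_id modules)

lemmas comult_is_linear = linear_maps_is_linear[OF comult_linear]
lemmas counit_is_linear = linear_maps_is_linear[OF counit_linear]
lemmas antipode_is_linear = linear_maps_is_linear[OF antipode_linear]

lemma counit_closed: "x \<in> carrier H \<Longrightarrow> \<epsilon> x \<in> carrier K"
  using is_linear_closed[OF counit_is_linear] by (simp add: base_module_def)

lemmas tm_linear = tensor_map_linear[OF H_module H_module H_module H_module]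
lemmas tm_pure = tensor_map_pure[OF H_module H_module H_module H_module]

lemmas closed = is_linear_closed[OF mu_linear] is_linear_closed[OF comult_is_linear]
  is_linear_closed[OF antipode_is_linear] counit_closed pure_tensor_closed[OF H_module H_module]

lemma swap_left_linear: "is_linear K H_HH H_HH swap_left"
proof -
  have "is_linear K H_HH H_HH
     (\<lambda>x. \<alpha> (tensor_map K HH H HH H (tensor_swap K H H) one_H (\<alpha>_inv x)))"
    by (intro is_linear_comp[OF tensor_assoc_linear] is_linear_comp[OF tensor_map_linear]
        tensor_assoc_inv_linear tensor_swap_linear one_linear modules)
  then show ?thesis
    by (simp add: swap_left_def comp_def)
qed

lemma swap_middle_linear: "is_linear K HH_HH HH_HH swap_middle"
proof -
  have "is_linear K HH_HH HH_HH
     (\<lambda>x. tensor_assoc_inv K H H HH (tensor_map K H H_HH H H_HH one_H swap_left (tensor_assoc K H H HH x)))"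
    by (intro is_linear_comp[OF tensor_assoc_inv_linear] is_linear_comp[OF tensor_map_linear]
        tensor_assoc_linear swap_left_linear one_linear modules)
  then show ?thesis
    by (simp add: swap_middle_def comp_def)
qed

section \<open>The adjoint map\<close>

lemma mult_sandwich_bilinear:
  assumes "is_linear K H H g" "is_linear K H H h" "x \<in> carrier H"
  shows "bilinear_map K H H H (\<lambda>a b. g a \<otimes>\<^bsub>H\<^esub> x \<otimes>\<^bsub>H\<^esub> h b)"
  by (intro bilinear_map_comp[OF mult_bilinear _ assms(2)]
      is_linear_comp[OF bilinear_map_left[OF mult_bilinear assms(3)]] assms)

text \<open>With \<open>x\<close> held fixed, \<open>ad\<close> at \<open>x\<close> tensor
  \<open>y\<close> is \<open>adx x\<close> at \<open>\<Delta> y\<close>. Naming the inner lift makes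
  it a linear function of an arbitrary tensor, which is what comparison on pure tensors
  requires.\<close>

definition adx where
  "adx x = tensor_lift K H H H (\<lambda>a b. S a \<otimes>\<^bsub>H\<^esub> x \<otimes>\<^bsub>H\<^esub> b)"

lemma adx_linear: "x \<in> carrier H \<Longrightarrow> is_linear K HH H (adx x)"
  unfolding adx_def
  by (intro tensor_lift_linear modules mult_sandwich_bilinear antipode_is_linear is_linear_id)

lemma adx_pure:
  "\<lbrakk>x \<in> carrier H; a \<in> carrier H; b \<in> carrier H\<rbrakk> \<Longrightarrow> adx x (pt a b) = S a \<otimes>\<^bsub>H\<^esub> x \<otimes>\<^bsub>H\<^esub> b"
  unfolding adx_def
  by (intro tensor_lift_pure modules mult_sandwich_bilinear antipode_is_linear is_linear_id)

text \<open>Linearity in \<open>y\<close> is composition with \<open>\<Delta>\<close>. Linearity in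
  \<open>x\<close> is of a different kind, because \<open>x\<close> is a parameter inside the lift
  and not its argument.\<close>

lemma adx_comult_bilinear: "bilinear_map K H H H (\<lambda>x y. adx x (\<Delta> y))"
  unfolding bilinear_map_iff
proof (intro conjI ballI)
  fix x assume x: "x \<in> carrier H"
  show "is_linear K H H (\<lambda>y. adx x (\<Delta> y))"
    by (intro is_linear_comp[OF adx_linear] comult_is_linear x)
  show "is_linear K H H (\<lambda>y. adx y (\<Delta> x))"
    unfolding adx_def using x
    by (intro tensor_lift_parameter_linear modules mult_sandwich_bilinear antipode_is_linear
        is_linear_id closed is_linear_comp[OF bilinear_map_left[OF mult_bilinear]]
        bilinear_map_right[OF mult_bilinear])
qed

lemma ad_linear: "is_linear K HH H ad"
  unfolding ad_def adx_def[symmetric] by (intro tensor_lift_linear modules adx_comult_bilinear)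

lemma ad_pure: "\<lbrakk>x \<in> carrier H; y \<in> carrier H\<rbrakk> \<Longrightarrow> ad (pt x y) = adx x (\<Delta> y)"
  unfolding ad_def adx_def[symmetric] by (intro tensor_lift_pure modules adx_comult_bilinear)

section \<open>Unit isomorphisms and contraction with the counit\<close>

definition scalL where "scalL = tensor_lift K B H H (\<lambda>c y. c \<odot>\<^bsub>H\<^esub> y)"
definition scalR where "scalR = tensor_lift K H B H (\<lambda>y c. c \<odot>\<^bsub>H\<^esub> y)"

lemma base_module_carrier: "carrier (base_module K) = carrier K"
  by (simp add: base_module_def)

lemma smult_bilinear: "bilinear_map K B H H (\<lambda>c y. c \<odot>\<^bsub>H\<^esub> y)"
  by (rule bilinear_mapI)
    (simp_all add: base_module_def smult_l_distr smult_r_distr smult_assoc1[symmetric] K.m_comm)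

lemma smult_bilinear': "bilinear_map K H B H (\<lambda>y c. c \<odot>\<^bsub>H\<^esub> y)"
  using smult_bilinear by (simp add: bilinear_map_iff)

lemma scal_linear: "is_linear K (tensor K B H) H scalL" "is_linear K (tensor K H B) H scalR"
  unfolding scalL_def scalR_def by (intro tensor_lift_linear modules smult_bilinear smult_bilinear')+

lemma scal_pure:
  assumes "y \<in> carrier H" "c \<in> carrier K"
  shows "scalL (pure_tensor K B H c y) = c \<odot>\<^bsub>H\<^esub> y"
    and "scalR (pure_tensor K H B y c) = c \<odot>\<^bsub>H\<^esub> y"
  unfolding scalL_def scalR_def using assms
  by (auto simp: base_module_carrier intro!: tensor_lift_pure smult_bilinear smult_bilinear' modules)

text \<open>\<open>epsL\<close> and \<open>epsR\<close> contract one tensor factor with the counit;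
  the counit axioms make both of them left inverses of \<open>\<Delta>\<close>.\<close>

definition epsL where "epsL t = scalL (tensor_map K H H B H \<epsilon> one_H t)"
definition epsR where "epsR t = scalR (tensor_map K H H H B one_H \<epsilon> t)"

lemma eps_linear: "is_linear K HH H epsL" "is_linear K HH H epsR"
  unfolding epsL_def epsR_def
  by (intro is_linear_comp[OF scal_linear(1)] is_linear_comp[OF scal_linear(2)] tensor_map_linear
      modules counit_is_linear one_linear)+

lemma eps_pure:
  assumes "a \<in> carrier H" "b \<in> carrier H"
  shows "epsL (pt a b) = \<epsilon> a \<odot>\<^bsub>H\<^esub> b" "epsR (pt a b) = \<epsilon> b \<odot>\<^bsub>H\<^esub> a"
  using assms
  by (simp_all add: epsL_def epsR_def scal_pure closed
      base_module_carrier tensor_map_pure[OF _ _ _ _ counit_is_linear one_linear]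
      tensor_map_pure[OF _ _ _ _ one_linear counit_is_linear] modules)

lemma eps_comult:
  assumes "x \<in> carrier H"
  shows "epsL (\<Delta> x) = x" "epsR (\<Delta> x) = x"
  using assms counit_left counit_right by (simp_all add: epsL_def epsR_def scalL_def scalR_def)

lemma counit_smult: "\<lbrakk>c \<in> carrier K; x \<in> carrier H\<rbrakk> \<Longrightarrow> \<epsilon> (c \<odot>\<^bsub>H\<^esub> x) = c \<otimes>\<^bsub>K\<^esub> \<epsilon> x"
  using is_linear_smult[OF counit_is_linear] by (simp add: base_module_def)

lemma counit_zero: "\<epsilon> \<zero>\<^bsub>H\<^esub> = \<zero>\<^bsub>K\<^esub>"
  using is_linear_zero[OF counit_is_linear] modules by (simp add: base_module_def)

text \<open>Convolving \<open>u * id = 0\<close> with \<open>S\<close> on the right gives \<open>u = u * (id * S) = 0\<close>.\<close>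

lemma convolution_id_cancel:
  assumes u: "is_linear K H H u"
    and zero: "\<And>x. x \<in> carrier H \<Longrightarrow> \<mu> (tm u one_H (\<Delta> x)) = \<zero>\<^bsub>H\<^esub>"
    and x: "x \<in> carrier H"
  shows "u x = \<zero>\<^bsub>H\<^esub>"
proof -
  \<comment> \<open>Here \<open>b\<close> groups the convolution of \<open>u\<close>, the identity
    and \<open>S\<close> as \<open>u * (id * S)\<close>, and \<open>b'\<close> groups it as
    \<open>(u * id) * S\<close>; \<open>P\<close> and \<open>R\<close> are the induced linear maps
    on the two bracketings of the triple tensor product.\<close>
  define b where "b = (\<lambda>a t. u a \<otimes>\<^bsub>H\<^esub> \<mu> (tm one_H S t))"
  define b' where "b' = (\<lambda>t c. \<mu> (tm u one_H t) \<otimes>\<^bsub>H\<^esub> S c)"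
  define P where "P = tensor_lift K H HH H b"
  define R where "R = tensor_lift K HH H H b'"
  have b: "bilinear_map K H HH H b" "bilinear_map K HH H H b'"
    unfolding b_def b'_def
    by (intro bilinear_map_comp[OF mult_bilinear] is_linear_comp[OF mu_linear] tm_linear
        one_linear antipode_is_linear u)+
  note P = tensor_lift_linear[OF H_module HH_module H_module b(1), folded P_def]
    and P_pure = tensor_lift_pure[OF H_module HH_module H_module b(1), folded P_def]
    and R = tensor_lift_linear[OF HH_module H_module H_module b(2), folded R_def]
    and R_pure = tensor_lift_pure[OF HH_module H_module H_module b(2), folded R_def]
  note u_closed = is_linear_closed[OF u]
  note assoc = tensor_assoc_linear[OF H_module H_module H_module]
  note pts = pure_tensor_closed[OF HH_module H_module] pure_tensor_closed[OF H_module HH_module]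
  \<comment> \<open>On three pure factors both sides multiply out \<open>u x\<close>,
    \<open>y\<close> and \<open>S c\<close>, so this is associativity of \<open>H\<close>
    transported along the associator.\<close>
  have assoc_pure: "P (\<alpha> (pure_tensor K HH H t c)) = R (pure_tensor K HH H t c)"
    if t: "t \<in> carrier HH" and c: "c \<in> carrier H" for t c
  proof (rule tensor_eqI[OF H_module H_module _ _ _ t, where P = H])
    show "is_linear K HH H (\<lambda>t. P (\<alpha> (pure_tensor K HH H t c)))"
      by (intro is_linear_comp[OF P] is_linear_comp[OF assoc]
          bilinear_map_left[OF pure_tensor_bilinear] modules c)
    show "is_linear K HH H (\<lambda>t. R (pure_tensor K HH H t c))"
      by (intro is_linear_comp[OF R] bilinear_map_left[OF pure_tensor_bilinear] modules c)
    fix x y assume "x \<in> carrier H" "y \<in> carrier H"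
    then show "P (\<alpha> (pure_tensor K HH H (pt x y) c)) = R (pure_tensor K HH H (pt x y) c)"
      using c by (simp add: tensor_assoc_pure modules P_pure R_pure closed b_def b'_def
          tm_pure[OF one_linear antipode_is_linear] tm_pure[OF u one_linear] mu_pure u_closed
          H.m_assoc)
  qed
  have assoc_eq: "P (\<alpha> w) = R w" if "w \<in> carrier HH_H" for w
    by (rule tensor_eqI[OF HH_module H_module _ R assoc_pure that])
      (intro is_linear_comp[OF P] assoc)
  note \<Delta>id = tensor_map[OF H_module H_module HH_module H_module comult_is_linear one_linear]
    and id\<Delta> = tensor_map[OF H_module H_module H_module HH_module one_linear comult_is_linear]
  have x1: "\<Delta> x \<in> carrier HH"
    using x by (simp add: closed)
  \<comment> \<open>The right antipode axiom collapses \<open>id * S\<close> to the counit times the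
    unit, and the scalar moves inside \<open>u\<close> by linearity.\<close>
  have "u (epsR (\<Delta> x)) = P (tensor_map K H H H HH one_H \<Delta> (\<Delta> x))"
  proof (rule tensor_eqI[OF H_module H_module _ _ _ x1, where P = H])
    show "is_linear K HH H (\<lambda>t. u (epsR t))"
      by (intro is_linear_comp[OF u] eps_linear)
    show "is_linear K HH H (\<lambda>t. P (tensor_map K H H H HH one_H \<Delta> t))"
      by (intro is_linear_comp[OF P] id\<Delta>)
    fix x y assume "x \<in> carrier H" "y \<in> carrier H"
    then show "u (epsR (pt x y)) = P (tensor_map K H H H HH one_H \<Delta> (pt x y))"
      by (simp add: eps_pure id\<Delta>(2) P_pure closed b_def antipode_right is_linear_smult[OF u]
          smult_mult_right u_closed)
  qed
  \<comment> \<open>Coassociativity passes to the other bracketing, where the hypothesis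
    \<open>u * id = 0\<close> applies.\<close>
  also have "\<dots> = R (tensor_map K H H HH H \<Delta> one_H (\<Delta> x))"
    using x by (simp add: coassoc[symmetric] assoc_eq is_linear_closed[OF \<Delta>id(1)] closed)
  also have "\<dots> = \<zero>\<^bsub>H\<^esub>"
  proof (rule tensor_eqI[OF H_module H_module _ is_linear_const_zero[OF H_module] _ x1])
    show "is_linear K HH H (\<lambda>t. R (tensor_map K H H HH H \<Delta> one_H t))"
      by (intro is_linear_comp[OF R] \<Delta>id)
    fix x y assume "x \<in> carrier H" "y \<in> carrier H"
    then show "R (tensor_map K H H HH H \<Delta> one_H (pt x y)) = \<zero>\<^bsub>H\<^esub>"
      by (simp add: \<Delta>id(2) R_pure closed b'_def zero)
  qed
  finally show ?thesis
    using x by (simp add: eps_comult)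
qed

section \<open>Maps that are both derivations and coderivations\<close>

lemma C1D:
  assumes "f \<in> C1"
  shows "is_linear K H H f"
    and "t \<in> carrier HH \<Longrightarrow> f (\<mu> t) = \<mu> (tm f one_H t) \<oplus>\<^bsub>H\<^esub> \<mu> (tm one_H f t)"
    and "x \<in> carrier H \<Longrightarrow> \<Delta> (f x) = tm f one_H (\<Delta> x) \<oplus>\<^bsub>HH\<^esub> tm one_H f (\<Delta> x)"
  using assms by (auto simp: C1_def linear_maps_is_linear)

lemma C1_mult:
  assumes f: "f \<in> C1" and xy: "x \<in> carrier H" "y \<in> carrier H"
  shows "f (x \<otimes>\<^bsub>H\<^esub> y) = f x \<otimes>\<^bsub>H\<^esub> y \<oplus>\<^bsub>H\<^esub> x \<otimes>\<^bsub>H\<^esub> f y"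
  using C1D(2)[OF f, of "pt x y"] xy is_linear_closed[OF C1D(1)[OF f]]
  by (simp add: closed mu_pure tm_pure[OF C1D(1)[OF f] one_linear] tm_pure[OF one_linear C1D(1)[OF f]])

text \<open>The Leibniz rule at the product of the unit with itself gives
  \<open>f \<one> = f \<one> + f \<one>\<close>, and one summand cancels.\<close>

lemma C1_one:
  assumes f: "f \<in> C1"
  shows "f \<one>\<^bsub>H\<^esub> = \<zero>\<^bsub>H\<^esub>"
  using C1_mult[OF f, of "\<one>\<^bsub>H\<^esub>" "\<one>\<^bsub>H\<^esub>"] is_linear_closed[OF C1D(1)[OF f], of "\<one>\<^bsub>H\<^esub>"]
  by simp

text \<open>Contracting the first factor of the coderivation identity with \<open>\<epsilon>\<close>
  produces \<open>f x\<close> on both sides, so the remaining term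
  \<open>\<epsilon> (f x\<^sub>1) x\<^sub>2\<close> is zero. A second application of
  \<open>\<epsilon>\<close> turns that term into \<open>\<epsilon> (f x)\<close>.\<close>

lemma C1_counit:
  assumes f: "f \<in> C1" and x: "x \<in> carrier H"
  shows "\<epsilon> (f x) = \<zero>\<^bsub>K\<^esub>"
proof -
  note lin = C1D(1)[OF f] and f_closed = is_linear_closed[OF C1D(1)[OF f]]
  have t: "\<Delta> x \<in> carrier HH"
    using x by (simp add: closed)
  have 1: "epsL (tm one_H f (\<Delta> x)) = f (epsL (\<Delta> x))"
    by (rule tensor_eqI[OF H_module H_module _ _ _ t, where P = H])
      ((intro is_linear_comp[OF eps_linear(1)] tm_linear one_linear lin is_linear_comp[OF lin] eps_linear)+,
        simp add: tm_pure[OF one_linear lin] eps_pure f_closed is_linear_smult[OF lin] closed)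
  \<comment> \<open>The scalar \<open>\<epsilon> (f a) \<epsilon> b\<close> is also
    \<open>\<epsilon> f\<close> at the multiple of \<open>a\<close> by \<open>\<epsilon> b\<close>,
    so the second contraction can be carried inside \<open>f\<close>, where the right counit law
    absorbs it.\<close>
  have 2: "\<epsilon> (epsL (tm f one_H (\<Delta> x))) = \<epsilon> (f (epsR (\<Delta> x)))"
    by (rule tensor_eqI[OF H_module H_module _ _ _ t, where P = B])
      ((intro is_linear_comp[OF counit_is_linear] is_linear_comp[OF eps_linear(1)] tm_linear
        one_linear lin is_linear_comp[OF lin] eps_linear)+,
        simp add: tm_pure[OF lin one_linear] eps_pure f_closed is_linear_smult[OF lin] closed
        counit_smult K.m_comm)
  have cl: "tm f one_H (\<Delta> x) \<in> carrier HH" "tm one_H f (\<Delta> x) \<in> carrier HH"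
    using t by (simp_all add: is_linear_closed[OF tm_linear] one_linear lin)
  have "f x = epsL (tm f one_H (\<Delta> x) \<oplus>\<^bsub>HH\<^esub> tm one_H f (\<Delta> x))"
    using eps_comult(1)[OF f_closed[OF x]] C1D(3)[OF f x] by simp
  also have "\<dots> = epsL (tm f one_H (\<Delta> x)) \<oplus>\<^bsub>H\<^esub> f x"
    using x cl by (simp add: is_linear_add[OF eps_linear(1)] 1 eps_comult)
  finally have "epsL (tm f one_H (\<Delta> x)) = \<zero>\<^bsub>H\<^esub>"
    using is_linear_closed[OF eps_linear(1) cl(1)] f_closed[OF x] by simp
  with 2 show ?thesis
    using x by (simp add: counit_zero eps_comult)
qed

text \<open>Vanishing at the unit is used for \<open>f S\<close>, vanishing of
  \<open>\<epsilon> f\<close> for \<open>S f\<close>: they make the right-hand sides of the two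
  expanded antipode identities zero.\<close>

lemma C1_antipode:
  assumes f: "f \<in> C1" and x: "x \<in> carrier H"
  shows "f (S x) = S (f x)"
proof -
  note lin = C1D(1)[OF f] and f_closed = is_linear_closed[OF C1D(1)[OF f]]
  note fS = is_linear_comp[OF lin antipode_is_linear] and Sf = is_linear_comp[OF antipode_is_linear lin]
  define u where "u = (\<lambda>y. f (S y) \<ominus>\<^bsub>H\<^esub> S (f y))"
  have u: "is_linear K H H u"
    unfolding u_def by (intro is_linear_diff modules fS Sf)
  have u_apply: "u y = f (S y) \<ominus>\<^bsub>H\<^esub> S (f y)" for y
    by (simp add: u_def)
  have "u x = \<zero>\<^bsub>H\<^esub>"
  proof (rule convolution_id_cancel[OF u _ x])
    fix y assume y: "y \<in> carrier H"
    then have t: "\<Delta> y \<in> carrier HH"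
      by (simp add: closed)
    \<comment> \<open>In convolution notation these are \<open>(f S) * id\<close>,
      \<open>(S f) * id\<close> and the term \<open>S * f\<close> that both expansions
      share.\<close>
    let ?A = "\<mu> (tm (\<lambda>y. f (S y)) one_H (\<Delta> y))"
      and ?B = "\<mu> (tm (\<lambda>y. S (f y)) one_H (\<Delta> y))"
      and ?C = "\<mu> (tm S f (\<Delta> y))"
    have cl: "?A \<in> carrier H" "?B \<in> carrier H" "?C \<in> carrier H"
      using t by (simp_all add: closed is_linear_closed[OF tm_linear] fS Sf one_linear lin antipode_is_linear)
    have 1: "\<mu> (tm u one_H (\<Delta> y)) = ?A \<ominus>\<^bsub>H\<^esub> ?B"
    proof (rule tensor_eqI[OF H_module H_module _ _ _ t, where P = H])
      show "is_linear K HH H (\<lambda>t. \<mu> (tm u one_H t))"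
        by (intro is_linear_comp[OF mu_linear] tm_linear u one_linear)
      show "is_linear K HH H
          (\<lambda>t. \<mu> (tm (\<lambda>y. f (S y)) one_H t) \<ominus>\<^bsub>H\<^esub> \<mu> (tm (\<lambda>y. S (f y)) one_H t))"
        by (intro is_linear_diff is_linear_comp[OF mu_linear] tm_linear fS Sf one_linear modules)
      fix a b assume "a \<in> carrier H" "b \<in> carrier H"
      then show "\<mu> (tm u one_H (pt a b)) =
          \<mu> (tm (\<lambda>y. f (S y)) one_H (pt a b)) \<ominus>\<^bsub>H\<^esub> \<mu> (tm (\<lambda>y. S (f y)) one_H (pt a b))"
        by (simp add: tm_pure u fS Sf one_linear u_apply mu_pure closed f_closed a_minus_def
            H.l_distr H.l_minus)
    qed
    have SC: "tm S one_H (\<Delta> y) \<in> carrier HH"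
      using t by (simp add: is_linear_closed[OF tm_linear] one_linear antipode_is_linear)
    \<comment> \<open>The Leibniz rule is applied at the tensor \<open>S y\<^sub>1\<close> tensor
      \<open>y\<^sub>2\<close>, whose product is a multiple of the unit, so that \<open>f\<close>
      sends it to zero.\<close>
    have "\<mu> (tm f one_H (tm S one_H (\<Delta> y))) = ?A"
      by (rule tensor_eqI[OF H_module H_module _ _ _ t, where P = H])
        ((intro is_linear_comp[OF mu_linear] is_linear_comp[OF tm_linear] tm_linear lin
          antipode_is_linear fS one_linear)+, simp add: tm_pure lin antipode_is_linear fS one_linear closed)
    moreover have "\<mu> (tm one_H f (tm S one_H (\<Delta> y))) = ?C"
      by (rule tensor_eqI[OF H_module H_module _ _ _ t, where P = H])
        ((intro is_linear_comp[OF mu_linear] is_linear_comp[OF tm_linear] tm_linear lin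
          antipode_is_linear one_linear)+, simp add: tm_pure lin antipode_is_linear one_linear closed f_closed)
    ultimately have "?A \<oplus>\<^bsub>H\<^esub> ?C = f (\<epsilon> y \<odot>\<^bsub>H\<^esub> \<one>\<^bsub>H\<^esub>)"
      using C1D(2)[OF f SC] antipode_left[OF y] by simp
    then have AC: "?A \<oplus>\<^bsub>H\<^esub> ?C = \<zero>\<^bsub>H\<^esub>"
      using y by (simp add: is_linear_smult[OF lin] closed C1_one[OF f])
    \<comment> \<open>The left antipode identity is now taken at \<open>f y\<close>, with
      \<open>\<Delta> (f y)\<close> expanded by the coderivation property; its right-hand side is
      \<open>\<epsilon> (f y)\<close> times the unit.\<close>
    have "\<mu> (tm S one_H (tm f one_H (\<Delta> y))) = ?B"
      by (rule tensor_eqI[OF H_module H_module _ _ _ t, where P = H])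
        ((intro is_linear_comp[OF mu_linear] is_linear_comp[OF tm_linear] tm_linear lin
          antipode_is_linear Sf one_linear)+, simp add: tm_pure lin antipode_is_linear Sf one_linear closed f_closed)
    moreover have "\<mu> (tm S one_H (tm one_H f (\<Delta> y))) = ?C"
      by (rule tensor_eqI[OF H_module H_module _ _ _ t, where P = H])
        ((intro is_linear_comp[OF mu_linear] is_linear_comp[OF tm_linear] tm_linear lin
          antipode_is_linear one_linear)+, simp add: tm_pure lin antipode_is_linear one_linear closed f_closed)
    moreover have "\<mu> (tm S one_H (\<Delta> (f y))) =
        \<mu> (tm S one_H (tm f one_H (\<Delta> y))) \<oplus>\<^bsub>H\<^esub> \<mu> (tm S one_H (tm one_H f (\<Delta> y)))"
      unfolding C1D(3)[OF f y]
      by (rule is_linear_add[OF is_linear_comp[OF mu_linear tm_linear]])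
        (use t in \<open>simp_all add: antipode_is_linear one_linear lin is_linear_closed[OF tm_linear]\<close>)
    ultimately have "?B \<oplus>\<^bsub>H\<^esub> ?C = \<zero>\<^bsub>H\<^esub>"
      using antipode_left[OF f_closed[OF y]] C1_counit[OF f y] by simp
    with AC have "?A \<oplus>\<^bsub>H\<^esub> ?C = ?B \<oplus>\<^bsub>H\<^esub> ?C"
      by (simp only:)
    with H.add.right_cancel[OF cl(3,1,2)] have "?A = ?B"
      by blast
    with 1 show "\<mu> (tm u one_H (\<Delta> y)) = \<zero>\<^bsub>H\<^esub>"
      using H.r_neg[OF cl(2)] by (simp only: a_minus_def)
  qed
  then show ?thesis
    using H.minus_equality[of "f (S x)" "\<ominus>\<^bsub>H\<^esub> S (f x)"] x
    by (simp add: u_apply a_minus_def closed f_closed)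
qed

section \<open>The two differentials\<close>

lemma D1_zero:
  assumes f: "f \<in> C1"
  shows "D1 f = zero_map HH H"
proof -
  note lin = C1D(1)[OF f] and f_closed = is_linear_closed[OF C1D(1)[OF f]]
  have adx_closed: "adx x s \<in> carrier H" if "x \<in> carrier H" "s \<in> carrier HH" for x s
    using that by (simp add: is_linear_closed[OF adx_linear])
  have tm_closed: "tm f one_H s \<in> carrier HH" "tm one_H f s \<in> carrier HH" if "s \<in> carrier HH" for s
    using that by (simp_all add: is_linear_closed[OF tm_linear] lin one_linear)
  \<comment> \<open>The Leibniz rule for the three factors \<open>S a\<close>, \<open>x\<close>,
    \<open>b\<close>; \<open>f S = S f\<close> turns the first term back into a value of
    \<open>adx x\<close>.\<close>
  have f_adx: "f (adx x s) =
      adx x (tm f one_H s) \<oplus>\<^bsub>H\<^esub> adx (f x) s \<oplus>\<^bsub>H\<^esub> adx x (tm one_H f s)"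
    if x: "x \<in> carrier H" and s: "s \<in> carrier HH" for x s
  proof (rule tensor_eqI[OF H_module H_module _ _ _ s, where P = H])
    show "is_linear K HH H (\<lambda>s. f (adx x s))"
      by (intro is_linear_comp[OF lin] adx_linear x)
    show "is_linear K HH H
        (\<lambda>s. adx x (tm f one_H s) \<oplus>\<^bsub>H\<^esub> adx (f x) s \<oplus>\<^bsub>H\<^esub> adx x (tm one_H f s))"
      by (intro is_linear_plus is_linear_comp[OF adx_linear] adx_linear tm_linear lin one_linear x
          f_closed modules)
    fix a b assume "a \<in> carrier H" "b \<in> carrier H"
    then show "f (adx x (pt a b)) = adx x (tm f one_H (pt a b)) \<oplus>\<^bsub>H\<^esub> adx (f x) (pt a b) \<oplus>\<^bsub>H\<^esub>
        adx x (tm one_H f (pt a b))"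
      using x by (simp add: tm_pure lin one_linear adx_pure closed f_closed C1_mult[OF f]
          C1_antipode[OF f] H.l_distr H.r_distr H.m_assoc H.a_assoc)
  qed
  have zero: "ad (tm one_H f t) \<ominus>\<^bsub>H\<^esub> f (ad t) \<oplus>\<^bsub>H\<^esub> ad (tm f one_H t) = \<zero>\<^bsub>H\<^esub>"
    if t: "t \<in> carrier HH" for t
  proof (rule tensor_eqI[OF H_module H_module _ is_linear_const_zero[OF H_module] _ t])
    show "is_linear K HH H (\<lambda>t. ad (tm one_H f t) \<ominus>\<^bsub>H\<^esub> f (ad t) \<oplus>\<^bsub>H\<^esub> ad (tm f one_H t))"
      by (intro is_linear_plus is_linear_diff is_linear_comp[OF ad_linear] tm_linear
          is_linear_comp[OF lin] ad_linear lin one_linear modules)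
    fix x y assume xy: "x \<in> carrier H" "y \<in> carrier H"
    let ?s = "\<Delta> y"
    let ?a = "adx x (tm f one_H ?s)" and ?b = "adx x (tm one_H f ?s)" and ?c = "adx (f x) ?s"
    have cl: "?a \<in> carrier H" "?b \<in> carrier H" "?c \<in> carrier H"
      using xy by (simp_all add: adx_closed tm_closed closed f_closed)
    \<comment> \<open>The coderivation property splits \<open>\<Delta> (f y)\<close>, so applying
      \<open>f\<close> to \<open>y\<close> supplies two of the three Leibniz terms; the third comes
      from applying it to \<open>x\<close>.\<close>
    have "ad (tm one_H f (pt x y)) = ?a \<oplus>\<^bsub>H\<^esub> ?b"
      using xy by (simp add: tm_pure one_linear lin ad_pure f_closed C1D(3)[OF f]
          is_linear_add[OF adx_linear] tm_closed closed)
    moreover have "ad (tm f one_H (pt x y)) = ?c"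
      using xy by (simp add: tm_pure one_linear lin ad_pure f_closed)
    moreover have "f (ad (pt x y)) = ?a \<oplus>\<^bsub>H\<^esub> ?c \<oplus>\<^bsub>H\<^esub> ?b"
      using xy by (simp add: ad_pure f_adx closed)
    moreover have "?a \<oplus>\<^bsub>H\<^esub> ?b \<ominus>\<^bsub>H\<^esub> (?a \<oplus>\<^bsub>H\<^esub> ?c \<oplus>\<^bsub>H\<^esub> ?b) \<oplus>\<^bsub>H\<^esub> ?c = \<zero>\<^bsub>H\<^esub>"
    proof -
      have "?a \<oplus>\<^bsub>H\<^esub> ?c \<oplus>\<^bsub>H\<^esub> ?b = ?c \<oplus>\<^bsub>H\<^esub> (?a \<oplus>\<^bsub>H\<^esub> ?b)"
        using cl by (simp add: H.a_ac)
      then show ?thesis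
        using cl by (simp add: a_minus_def H.minus_add H.r_neg H.l_neg H.a_ac)
    qed
    ultimately show "ad (tm one_H f (pt x y)) \<ominus>\<^bsub>H\<^esub> f (ad (pt x y)) \<oplus>\<^bsub>H\<^esub>
        ad (tm f one_H (pt x y)) = \<zero>\<^bsub>H\<^esub>"
      by simp
  qed
  \<comment> \<open>Equality holds as extensional functions, so the zero map can be substituted into
    \<open>D2\<close>.\<close>
  show ?thesis
    unfolding D1_def zero_map_def by (rule restrict_ext) (rule zero)
qed

text \<open>Each term dies where the cochain enters: the cochain is evaluated to zero directly, or
  it makes a tensor map zero, and the linear maps applied afterwards preserve zero.\<close>

lemma D2_zero: "D2 (zero_map HH H) = zero_C3"
proof -
  let ?z = "zero_map HH H"
  interpret HH: module K HH by (rule HH_module)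
  have z: "is_linear K HH H ?z"
    unfolding zero_map_def
    by (rule is_linear_cong[OF HH_module is_linear_const_zero[OF H_module]]) simp
  have z0: "?z t = \<zero>\<^bsub>H\<^esub>" if "t \<in> carrier HH" for t
    using that by (simp add: zero_map_def)
  note maps = tensor_map_linear[OF _ _ _ _ z one_linear] tensor_map_linear[OF _ _ _ _ ad_linear one_linear]
    tensor_map_linear[OF _ _ _ _ one_linear mu_linear] tensor_map_linear[OF _ _ _ _ one_linear z]
    tensor_map_linear[OF _ _ _ _ comult_is_linear comult_is_linear]
    tensor_map_linear[OF _ _ _ _ one_linear comult_is_linear]
    tensor_assoc_linear swap_left_linear swap_middle_linear
  have "d21 ?z = zero_map HH_H H"
    unfolding d21_def zero_map_def[of HH_H]
  proof (rule restrict_ext)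
    fix t assume t: "t \<in> carrier HH_H"
    have "tensor_map K HH H H H ?z one_H t = \<zero>\<^bsub>HH\<^esub>"
      by (rule tensor_map_zero_left) (use t z0 one_linear in \<open>simp_all add: modules\<close>)
    moreover have "tensor_map K HH H H H ad one_H t \<in> carrier HH"
      using t by (simp add: is_linear_closed[OF maps(2)] modules)
    moreover have "tensor_map K H HH H H one_H \<mu> (\<alpha> t) \<in> carrier HH"
      using t by (simp add: is_linear_closed[OF maps(3)] is_linear_closed[OF tensor_assoc_linear] modules)
    ultimately show "ad (tensor_map K HH H H H ?z one_H t) \<oplus>\<^bsub>H\<^esub> ?z (tensor_map K HH H H H ad one_H t)
        \<ominus>\<^bsub>H\<^esub> ?z (tensor_map K H HH H H one_H \<mu> (\<alpha> t)) = \<zero>\<^bsub>H\<^esub>"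
      by (simp add: z0 is_linear_zero[OF ad_linear] modules a_minus_def)
  qed
  moreover have "d22 ?z = zero_map HH HH"
    unfolding d22_def zero_map_def[of HH HH] comp_def
  proof (rule restrict_ext)
    fix t assume t: "t \<in> carrier HH"
    have "tensor_map K HH HH H H ?z \<mu> (swap_middle (tensor_map K H H HH HH \<Delta> \<Delta> t)) = \<zero>\<^bsub>HH\<^esub>"
      by (rule tensor_map_zero_left)
        (use t z0 in \<open>simp_all add: mu_linear is_linear_closed[OF swap_middle_linear]
          is_linear_closed[OF maps(5)] modules\<close>)
    moreover have "tensor_map K H HH H H one_H ?z (swap_left (tensor_map K H H H HH one_H \<Delta> t)) = \<zero>\<^bsub>HH\<^esub>"
      by (rule tensor_map_zero_right)
        (use t z0 in \<open>simp_all add: one_linear is_linear_closed[OF swap_left_linear]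
          is_linear_closed[OF maps(6)] modules\<close>)
    \<comment> \<open>The cochain acts in the middle of this composite, so zero still has to travel
      through \<open>1 \<otimes> \<Delta>\<close>, the swap and
      \<open>1 \<otimes> \<mu>\<close>.\<close>
    moreover have "tensor_map K H HH H H one_H \<mu>
        (swap_left (tensor_map K H H H HH one_H \<Delta> \<zero>\<^bsub>HH\<^esub>)) = \<zero>\<^bsub>HH\<^esub>"
      by (simp add: is_linear_zero[OF maps(3)] is_linear_zero[OF maps(6)]
          is_linear_zero[OF swap_left_linear] modules)
    ultimately show "tensor_map K HH HH H H ?z \<mu> (swap_middle (tensor_map K H H HH HH \<Delta> \<Delta> t)) \<ominus>\<^bsub>HH\<^esub>
        tensor_map K H HH H H one_H \<mu> (swap_left (tensor_map K H H H HH one_H \<Delta>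
          (tensor_map K H HH H H one_H ?z (swap_left (tensor_map K H H H HH one_H \<Delta> t))))) = \<zero>\<^bsub>HH\<^esub>"
      by (simp add: a_minus_def)
  qed
  ultimately show ?thesis
    by (simp add: D2_def zero_C3_def)
qed

end

theorem theorem4p3:
  fixes K :: "('k, 'm) ring_scheme"
    and H :: "('k, 'a, 'n) module_scheme"
    and \<Delta> :: "'a \<Rightarrow> ('a \<times> 'a \<Rightarrow> 'k) set"
    and \<epsilon> :: "'a \<Rightarrow> 'k"
    and S :: "'a \<Rightarrow> 'a"
  assumes "hopf_algebra K H \<Delta> \<epsilon> S"
  shows "\<forall>f \<in> hopf_data.C1 K H \<Delta>.
    hopf_data.D2 K H \<Delta> S (hopf_data.D1 K H \<Delta> S f) = hopf_data.zero_C3 K H"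
  using hopf_algebra.D1_zero[OF assms] hopf_algebra.D2_zero[OF assms] by simp

end
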